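(* Let $\mathcal{M}_b$ be a bounded model specification. For every constrained model instance $\langle G,\rho\rangle \in \llbracket \mathcal{M}_b\rrbracket$, there exists a retained accepted state $S$ reachable (via $\Rightarrow^*$) from $\mathsf{init}(\mathcal{M}_b,\texttt{find})$ such that $\langle G,\rho\rangle \in \llbracket S\rrbracket$.
   Context: Setting (Maude Model Finder calculus). A schema $\mathcal{S}$ declares classes, attributes, subclass relations and roles $r:C\to D$. An object configuration $G$ is a finite multiset of object records $\langle o:C\mid \mathrm{AS}\rangle$ modulo ACU; $G:\mathcal{S}$ means $G$ respects the schema's declarations and typing. A core specification $\mathcal{M}=(\mathcal{S},\mathsf{Inv}^{\mathsf{part}}_{\mathsf{graph}},\mathsf{Inv}^{\mathsf{full}}_{\mathsf{graph}},\mathsf{Inv}_{\mathsf{attr}})$ has a monotonic partial-graph invariant (including unique identifiers, reference sets within upper multiplicities, bound consistency), a full-graph invariant, and an attribute invariant given by user hooks $\mathsf{specInvOnCreate}(K,o)$ and $\mathsf{specInvOnSetRef}(K,R,o,v)$ returning Boolean SMT constraints over attribute symbols $i(o,a),b(o,a),r(o,a)$. $\mathcal{M}_b=(\mathcal{M},b)$ where $b$ gives class intervals $[\ell_C,u_C]$ and role intervals $[\ell_r,u_r]$; $G:\mathcal{S}_b$ means $G:\mathcal{S}$ and all cardinalities are within these intervals. A constrained model instance $\langle G,\rho\rangle$ ($\rho$ a ground valuation of attribute symbols) conforms to $\mathcal{M}_b$ iff $G:\mathcal{S}_b$, $G\models\mathsf{Inv}^{\mathsf{part}}_{\mathsf{graph}}$,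 $G\models\mathsf{Inv}^{\mathsf{full}}_{\mathsf{graph}}$, $\rho\models\mathsf{Inv}_{\mathsf{attr}}(G)$; $\llbracket\mathcal{M}_b\rrbracket$ is the set of these. Runtime states $\langle\mathcal{C}\mid\phi\rangle$: $\phi$ a Boolean constraint, $\mathcal{C}$ a multiset of object records and control tokens (phase marker $\mathsf{objectBuild}/\mathsf{refBuild}$, identifier universe $\mathsf{allIds}$, allocation list $\mathsf{freshIds}$, $\mathsf{takenIds}$, counters $\mathsf{missing}(K,n)$, $\mathsf{need}(K,n)$, task list $\mathsf{refPool}$ of tasks $\mathsf{refIdx}(o,R,K',\mathit{curr},\mathit{REM})$). $\pi(\mathcal{C})$ keeps only object records; $\llbracket\langle\mathcal{C}\mid\phi\rangle\rrbracket=\{\langle\pi(\mathcal{C}),\rho\rangle\mid\rho\models\phi\}$. $\mathsf{init}(\mathcal{M}_b,\texttt{find})=\langle\mathcal{C}_0\mid\mathsf{true}\rangle$ with phase $\mathsf{objectBuild}$, identifiers preallocated up to the upper bounds $u_C$ and linearized in a fixed canonical allocation list, and tokens $\mathsf{missing}(C,\ell_C)$, $\mathsf{need}(C,\mathrm{inNeed}(C))$ ($\mathrm{inNeed}(C)$ the maximal lower multiplicity of roles into $C$). Steps $\Rightarrow$ apply a rule modulo axioms $B$, normalize by the equations modulo $B$, and update $\phi$ to $\mathsf{simpB}(\phi\wedge h)$. Rules: Obj-Gen (consume the head identifier $o_K$ of the allocation list, create an object of class $K$ with placeholder attributes, decrement $\mathsf{missing}(K,\cdot),\mathsf{need}(K,\cdot)$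 saturating, enqueue one reference task per role of $K$, $h=\mathsf{specInvOnCreate}(K,o_K)$); Obj-Skip (drop the head identifier when $\mathsf{missing}(K,0)$ and $\mathsf{need}(K,0)$ hold); on exhaustion of the allocation list switch to $\mathsf{refBuild}$, restricting the universe to $\mathsf{takenIds}$. For role $R$ with bounds $[\ell,u]$ and allocated targets $\mathit{os}$, the domain $\mathcal{D}=\bigcup_{m=\ell}^u\{X\subseteq\mathit{os}:|X|=m\}$ is canonically enumerated (by size, then lexicographic unranking), tasks start with $\mathit{curr}=0,\mathit{REM}=|\mathcal{D}|-1$; Ref-Choose sets the role of $o$ to the $\mathit{curr}$-th element $v$ and removes the task, $h=\mathsf{specInvOnSetRef}(K,R,o,v)$; Ref-Skip (if $\mathit{REM}>0$) moves to $\mathit{curr}+1,\mathit{REM}-1$. $\mathsf{NF}(S)$: no rule applies. $\mathsf{Accept}_{\mathtt{find}}(\langle\mathcal{C}\mid\phi\rangle)$: $\mathsf{NF}$, $\pi(\mathcal{C})\models\mathsf{Inv}^{\mathsf{part}}_{\mathsf{graph}}$, $\phi$ satisfiable, $\pi(\mathcal{C})\models\mathsf{Inv}^{\mathsf{full}}_{\mathsf{graph}}$. Retention. The semantic coverage preorder is $S_1\preceq S_2$ iff $\llbracket S_2\rrbracket\subseteq\llbracket S_1\rrbracket$. The search engine uses a sound test $\mathtt{subsumes}(S_1,S_2)$ (equal shape index, a substitution $\sigma$ with $\pi(\mathcal{C}_2)=\pi(\mathcal{C}_1)\sigma$ modulo the equational theory, and SMT-checked entailment $\phi_2\models\phi_1\sigma$),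 which implies $S_1\preceq S_2$. The engine maintains a covering antichain $\mathcal{A}$ of explored accepted normal-form representatives: no two members mutually subsume, a candidate normal form is discarded only if some member of $\mathcal{A}$ subsumes it, and a new representative evicts members it subsumes. An accepted state is retained if it belongs to $\mathcal{A}$.
   Formalization: Proved literally if G uses only preallocated identifiers, including each class's unskippable first ones (else false); for other G, up to class-preserving renaming, if each class K has at least min(u_K, inNeed(K)) objects and hooks/invariants ignore identifier choice. *)

theory Defs
  imports Complex_Main "HOL-Library.Multiset"
begin

section \<open>Boolean SMT constraints over attribute symbols\<close>

type_synonym cls = string
type_synonym attr = string
type_synonym role = string

text \<open>The parameter \<open>'o\<close> is the type of object identifiers; \<open>ISym o a\<close>, \<open>BSym o a\<close>
  and \<open>RSym o a\<close> are the attribute symbols \<open>i(o,a)\<close>, \<open>b(o,a)\<close> and \<open>r(o,a)\<close>.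
  The other constructors are those of the SMT-LIB theories Core, Ints and Reals-Ints.\<close>

datatype 'o iexp =
    ISym 'o attr | IConst int | INeg "'o iexp"
  | IAdd "'o iexp" "'o iexp" | ISub "'o iexp" "'o iexp" | IMul "'o iexp" "'o iexp"
  | IDiv "'o iexp" "'o iexp" | IMod "'o iexp" "'o iexp"
  | IIte "'o bexp" "'o iexp" "'o iexp" | IFloor "'o rexp"
and 'o rexp =
    RSym 'o attr | RConst rat | RNeg "'o rexp"
  | RAdd "'o rexp" "'o rexp" | RSub "'o rexp" "'o rexp" | RMul "'o rexp" "'o rexp"
  | RDiv "'o rexp" "'o rexp"
  | RIte "'o bexp" "'o rexp" "'o rexp" | ROfInt "'o iexp"
and 'o bexp =
    BSym 'o attr | BConst bool | BNot "'o bexp"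
  | BAnd "'o bexp" "'o bexp" | BOr "'o bexp" "'o bexp" | BXor "'o bexp" "'o bexp"
  | BImp "'o bexp" "'o bexp" | BIff "'o bexp" "'o bexp"
  | BIte "'o bexp" "'o bexp" "'o bexp"
  | IEq "'o iexp" "'o iexp" | ILe "'o iexp" "'o iexp" | ILt "'o iexp" "'o iexp"
  | IDvd int "'o iexp"
  | REq "'o rexp" "'o rexp" | RLe "'o rexp" "'o rexp" | RLt "'o rexp" "'o rexp"
  | RIsInt "'o rexp"

record 'o valuation =
  ival :: "'o \<Rightarrow> attr \<Rightarrow> int"
  rval :: "'o \<Rightarrow> attr \<Rightarrow> real"
  bval :: "'o \<Rightarrow> attr \<Rightarrow> bool"

text \<open>Integer division is the Euclidean one of SMT-LIB (the remainder is never negative), which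
  differs from \<open>div\<close> for negative divisors.  Division by zero, which SMT-LIB leaves open, is
  totalised as in HOL.\<close>

definition smt_div :: "int \<Rightarrow> int \<Rightarrow> int" where
  "smt_div m n = (if 0 \<le> n then m div n else - (m div (- n)))"

definition smt_mod :: "int \<Rightarrow> int \<Rightarrow> int" where
  "smt_mod m n = m mod \<bar>n\<bar>"

primrec eval_i :: "'o valuation \<Rightarrow> 'o iexp \<Rightarrow> int"
  and eval_r :: "'o valuation \<Rightarrow> 'o rexp \<Rightarrow> real"
  and sat :: "'o valuation \<Rightarrow> 'o bexp \<Rightarrow> bool"
where
  "eval_i \<rho> (ISym x a) = ival \<rho> x a"
| "eval_i \<rho> (IConst n) = n"
| "eval_i \<rho> (INeg s) = - eval_i \<rho> s"
| "eval_i \<rho> (IAdd s t) = eval_i \<rho> s + eval_i \<rho> t"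
| "eval_i \<rho> (ISub s t) = eval_i \<rho> s - eval_i \<rho> t"
| "eval_i \<rho> (IMul s t) = eval_i \<rho> s * eval_i \<rho> t"
| "eval_i \<rho> (IDiv s t) = smt_div (eval_i \<rho> s) (eval_i \<rho> t)"
| "eval_i \<rho> (IMod s t) = smt_mod (eval_i \<rho> s) (eval_i \<rho> t)"
| "eval_i \<rho> (IIte c s t) = (if sat \<rho> c then eval_i \<rho> s else eval_i \<rho> t)"
| "eval_i \<rho> (IFloor u) = \<lfloor>eval_r \<rho> u\<rfloor>"
| "eval_r \<rho> (RSym x a) = rval \<rho> x a"
| "eval_r \<rho> (RConst q) = of_rat q"
| "eval_r \<rho> (RNeg s) = - eval_r \<rho> s"
| "eval_r \<rho> (RAdd s t) = eval_r \<rho> s + eval_r \<rho> t"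
| "eval_r \<rho> (RSub s t) = eval_r \<rho> s - eval_r \<rho> t"
| "eval_r \<rho> (RMul s t) = eval_r \<rho> s * eval_r \<rho> t"
| "eval_r \<rho> (RDiv s t) = eval_r \<rho> s / eval_r \<rho> t"
| "eval_r \<rho> (RIte c s t) = (if sat \<rho> c then eval_r \<rho> s else eval_r \<rho> t)"
| "eval_r \<rho> (ROfInt u) = of_int (eval_i \<rho> u)"
| "sat \<rho> (BSym x a) = bval \<rho> x a"
| "sat \<rho> (BConst v) = v"
| "sat \<rho> (BNot p) = (\<not> sat \<rho> p)"
| "sat \<rho> (BAnd p q) = (sat \<rho> p \<and> sat \<rho> q)"
| "sat \<rho> (BOr p q) = (sat \<rho> p \<or> sat \<rho> q)"
| "sat \<rho> (BXor p q) = (sat \<rho> p \<noteq> sat \<rho> q)"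
| "sat \<rho> (BImp p q) = (sat \<rho> p \<longrightarrow> sat \<rho> q)"
| "sat \<rho> (BIff p q) = (sat \<rho> p \<longleftrightarrow> sat \<rho> q)"
| "sat \<rho> (BIte c p q) = (if sat \<rho> c then sat \<rho> p else sat \<rho> q)"
| "sat \<rho> (IEq s t) = (eval_i \<rho> s = eval_i \<rho> t)"
| "sat \<rho> (ILe s t) = (eval_i \<rho> s \<le> eval_i \<rho> t)"
| "sat \<rho> (ILt s t) = (eval_i \<rho> s < eval_i \<rho> t)"
| "sat \<rho> (IDvd n t) = (n dvd eval_i \<rho> t)"
| "sat \<rho> (REq u v) = (eval_r \<rho> u = eval_r \<rho> v)"
| "sat \<rho> (RLe u v) = (eval_r \<rho> u \<le> eval_r \<rho> v)"
| "sat \<rho> (RLt u v) = (eval_r \<rho> u < eval_r \<rho> v)"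
| "sat \<rho> (RIsInt u) = (eval_r \<rho> u \<in> \<int>)"

definition satisfiable :: "'o bexp \<Rightarrow> bool" where
  "satisfiable \<phi> \<longleftrightarrow> (\<exists>\<rho>. sat \<rho> \<phi>)"

definition entails :: "'o bexp \<Rightarrow> 'o bexp \<Rightarrow> bool" where
  "entails \<phi> \<psi> \<longleftrightarrow> (\<forall>\<rho>. sat \<rho> \<phi> \<longrightarrow> sat \<rho> \<psi>)"

record 'o substitution =
  isub :: "'o \<Rightarrow> attr \<Rightarrow> 'o iexp"
  rsub :: "'o \<Rightarrow> attr \<Rightarrow> 'o rexp"
  bsub :: "'o \<Rightarrow> attr \<Rightarrow> 'o bexp"

primrec subst_i :: "'o substitution \<Rightarrow> 'o iexp \<Rightarrow> 'o iexp"
  and subst_r :: "'o substitution \<Rightarrow> 'o rexp \<Rightarrow> 'o rexp"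
  and subst_b :: "'o substitution \<Rightarrow> 'o bexp \<Rightarrow> 'o bexp"
where
  "subst_i \<sigma> (ISym x a) = isub \<sigma> x a"
| "subst_i \<sigma> (IConst n) = IConst n"
| "subst_i \<sigma> (INeg s) = INeg (subst_i \<sigma> s)"
| "subst_i \<sigma> (IAdd s t) = IAdd (subst_i \<sigma> s) (subst_i \<sigma> t)"
| "subst_i \<sigma> (ISub s t) = ISub (subst_i \<sigma> s) (subst_i \<sigma> t)"
| "subst_i \<sigma> (IMul s t) = IMul (subst_i \<sigma> s) (subst_i \<sigma> t)"
| "subst_i \<sigma> (IDiv s t) = IDiv (subst_i \<sigma> s) (subst_i \<sigma> t)"
| "subst_i \<sigma> (IMod s t) = IMod (subst_i \<sigma> s) (subst_i \<sigma> t)"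
| "subst_i \<sigma> (IIte c s t) = IIte (subst_b \<sigma> c) (subst_i \<sigma> s) (subst_i \<sigma> t)"
| "subst_i \<sigma> (IFloor u) = IFloor (subst_r \<sigma> u)"
| "subst_r \<sigma> (RSym x a) = rsub \<sigma> x a"
| "subst_r \<sigma> (RConst q) = RConst q"
| "subst_r \<sigma> (RNeg s) = RNeg (subst_r \<sigma> s)"
| "subst_r \<sigma> (RAdd s t) = RAdd (subst_r \<sigma> s) (subst_r \<sigma> t)"
| "subst_r \<sigma> (RSub s t) = RSub (subst_r \<sigma> s) (subst_r \<sigma> t)"
| "subst_r \<sigma> (RMul s t) = RMul (subst_r \<sigma> s) (subst_r \<sigma> t)"
| "subst_r \<sigma> (RDiv s t) = RDiv (subst_r \<sigma> s) (subst_r \<sigma> t)"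
| "subst_r \<sigma> (RIte c s t) = RIte (subst_b \<sigma> c) (subst_r \<sigma> s) (subst_r \<sigma> t)"
| "subst_r \<sigma> (ROfInt u) = ROfInt (subst_i \<sigma> u)"
| "subst_b \<sigma> (BSym x a) = bsub \<sigma> x a"
| "subst_b \<sigma> (BConst v) = BConst v"
| "subst_b \<sigma> (BNot p) = BNot (subst_b \<sigma> p)"
| "subst_b \<sigma> (BAnd p q) = BAnd (subst_b \<sigma> p) (subst_b \<sigma> q)"
| "subst_b \<sigma> (BOr p q) = BOr (subst_b \<sigma> p) (subst_b \<sigma> q)"
| "subst_b \<sigma> (BXor p q) = BXor (subst_b \<sigma> p) (subst_b \<sigma> q)"
| "subst_b \<sigma> (BImp p q) = BImp (subst_b \<sigma> p) (subst_b \<sigma> q)"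
| "subst_b \<sigma> (BIff p q) = BIff (subst_b \<sigma> p) (subst_b \<sigma> q)"
| "subst_b \<sigma> (BIte c p q) = BIte (subst_b \<sigma> c) (subst_b \<sigma> p) (subst_b \<sigma> q)"
| "subst_b \<sigma> (IEq s t) = IEq (subst_i \<sigma> s) (subst_i \<sigma> t)"
| "subst_b \<sigma> (ILe s t) = ILe (subst_i \<sigma> s) (subst_i \<sigma> t)"
| "subst_b \<sigma> (ILt s t) = ILt (subst_i \<sigma> s) (subst_i \<sigma> t)"
| "subst_b \<sigma> (IDvd n t) = IDvd n (subst_i \<sigma> t)"
| "subst_b \<sigma> (REq u v) = REq (subst_r \<sigma> u) (subst_r \<sigma> v)"
| "subst_b \<sigma> (RLe u v) = RLe (subst_r \<sigma> u) (subst_r \<sigma> v)"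
| "subst_b \<sigma> (RLt u v) = RLt (subst_r \<sigma> u) (subst_r \<sigma> v)"
| "subst_b \<sigma> (RIsInt u) = RIsInt (subst_r \<sigma> u)"


section \<open>Object configurations\<close>

text \<open>\<open>Oid K n\<close> is the \<open>n\<close>-th identifier of class \<open>K\<close>.\<close>

datatype oid = Oid (oid_class: cls) (oid_index: nat)

datatype sort = SInt | SReal | SBool

datatype 'o aval = AInt "'o iexp" | AReal "'o rexp" | ABool "'o bexp"

text \<open>A role that is mapped to \<open>None\<close> carries no reference set yet.\<close>

datatype obj = Obj
  (ident: oid)
  (class_of: cls)
  (atts: "attr \<Rightarrow> oid aval option")
  (refs: "role \<Rightarrow> oid set option")

type_synonym config = "obj multiset"

definition idents :: "config \<Rightarrow> oid set" where
  "idents G = ident ` set_mset G"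

definition population :: "config \<Rightarrow> cls \<Rightarrow> nat" where
  "population G K = size (filter_mset (\<lambda>x. class_of x = K) G)"


section \<open>Specifications\<close>

text \<open>\<open>attr_decl\<close> and \<open>role_list\<close>/\<open>src\<close> give own declarations; they are inherited along
  \<open>subclass_decl\<close>, whose pairs are (subclass, superclass).  The lists fix the declaration order.\<close>

record schema =
  class_list :: "cls list"
  subclass_decl :: "(cls \<times> cls) set"
  attr_decl :: "cls \<Rightarrow> attr \<Rightarrow> sort option"
  role_list :: "role list"
  src :: "role \<Rightarrow> cls"
  tgt :: "role \<Rightarrow> cls"

definition subcls :: "schema \<Rightarrow> cls \<Rightarrow> cls \<Rightarrow> bool" where
  "subcls \<S> K K' \<longleftrightarrow> (K, K') \<in> (subclass_decl \<S>)\<^sup>*"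

definition attr_sort :: "schema \<Rightarrow> cls \<Rightarrow> attr \<Rightarrow> sort option" where
  "attr_sort \<S> K a =
     (if \<exists>K'. subcls \<S> K K' \<and> attr_decl \<S> K' a \<noteq> None
      then Some (THE s. \<exists>K'. subcls \<S> K K' \<and> attr_decl \<S> K' a = Some s)
      else None)"

definition roles_of :: "schema \<Rightarrow> cls \<Rightarrow> role list" where
  "roles_of \<S> K = filter (\<lambda>R. subcls \<S> K (src \<S> R)) (role_list \<S>)"

definition wf_schema :: "schema \<Rightarrow> bool" where
  "wf_schema \<S> \<longleftrightarrow>
     distinct (class_list \<S>) \<and> distinct (role_list \<S>) \<and>
     subclass_decl \<S> \<subseteq> set (class_list \<S>) \<times> set (class_list \<S>) \<and> acyclic (subclass_decl \<S>) \<and>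
     (\<forall>R \<in> set (role_list \<S>). src \<S> R \<in> set (class_list \<S>) \<and> tgt \<S> R \<in> set (class_list \<S>)) \<and>
     (\<forall>K. finite (dom (attr_decl \<S> K))) \<and>
     (\<forall>K K1 K2 a s1 s2. subcls \<S> K K1 \<and> subcls \<S> K K2 \<and>
        attr_decl \<S> K1 a = Some s1 \<and> attr_decl \<S> K2 a = Some s2 \<longrightarrow> s1 = s2)"

fun symbol :: "sort \<Rightarrow> 'o \<Rightarrow> attr \<Rightarrow> 'o aval" where
  "symbol SInt x a = AInt (ISym x a)"
| "symbol SReal x a = AReal (RSym x a)"
| "symbol SBool x a = ABool (BSym x a)"

definition placeholders :: "schema \<Rightarrow> cls \<Rightarrow> oid \<Rightarrow> attr \<Rightarrow> oid aval option" where
  "placeholders \<S> K x a = map_option (\<lambda>s. symbol s x a) (attr_sort \<S> K a)"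

text \<open>\<open>extra_part\<close> is the specification-dependent conjunct of the partial-graph invariant, next to
  the predefined ones (see \<open>inv_part\<close> below).\<close>

record bounded_spec =
  schema :: schema
  extra_part :: "config \<Rightarrow> bool"
  inv_full :: "config \<Rightarrow> bool"
  on_create :: "cls \<Rightarrow> oid \<Rightarrow> oid bexp"
  on_set_ref :: "cls \<Rightarrow> role \<Rightarrow> oid \<Rightarrow> oid set \<Rightarrow> oid bexp"
  class_lo :: "cls \<Rightarrow> nat"
  class_up :: "cls \<Rightarrow> nat"
  role_lo :: "role \<Rightarrow> nat"
  role_up :: "role \<Rightarrow> nat"

abbreviation classes :: "bounded_spec \<Rightarrow> cls set" where
  "classes M \<equiv> set (class_list (schema M))"

text \<open>A configuration is extended by adding objects and by setting references that are not set.\<close>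

definition obj_le :: "obj \<Rightarrow> obj \<Rightarrow> bool" where
  "obj_le x y \<longleftrightarrow> ident x = ident y \<and> class_of x = class_of y \<and> atts x = atts y \<and>
     refs x \<subseteq>\<^sub>m refs y"

definition extends :: "config \<Rightarrow> config \<Rightarrow> bool" where
  "extends G G' \<longleftrightarrow> (\<exists>H. H \<subseteq># G' \<and> rel_mset obj_le G H)"

definition monotonic :: "(config \<Rightarrow> bool) \<Rightarrow> bool" where
  "monotonic P \<longleftrightarrow> (\<forall>G G'. extends G G' \<and> P G' \<longrightarrow> P G)"

definition wf_spec :: "bounded_spec \<Rightarrow> bool" where
  "wf_spec M \<longleftrightarrow> wf_schema (schema M) \<and> monotonic (extra_part M)"

definition respects_schema :: "schema \<Rightarrow> config \<Rightarrow> bool" where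
  "respects_schema \<S> G \<longleftrightarrow> (\<forall>x \<in># G.
     class_of x \<in> set (class_list \<S>) \<and>
     oid_class (ident x) = class_of x \<and>
     atts x = placeholders \<S> (class_of x) (ident x) \<and>
     dom (refs x) = set (roles_of \<S> (class_of x)) \<and>
     (\<forall>R X. refs x R = Some X \<longrightarrow>
        X \<subseteq> {ident y | y. y \<in># G \<and> subcls \<S> (class_of y) (tgt \<S> R)}))"

definition respects_bounds :: "bounded_spec \<Rightarrow> config \<Rightarrow> bool" where
  "respects_bounds M G \<longleftrightarrow>
     respects_schema (schema M) G \<and>
     (\<forall>K \<in> classes M. class_lo M K \<le> population G K \<and> population G K \<le> class_up M K) \<and>
     (\<forall>x \<in># G. \<forall>R X. refs x R = Some X \<longrightarrow> role_lo M R \<le> card X \<and> card X \<le> role_up M R)"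

definition inv_part :: "bounded_spec \<Rightarrow> config \<Rightarrow> bool" where
  "inv_part M G \<longleftrightarrow>
     (\<forall>i. size (filter_mset (\<lambda>x. ident x = i) G) \<le> 1) \<and>
     (\<forall>x \<in># G. \<forall>R X. refs x R = Some X \<longrightarrow> finite X \<and> card X \<le> role_up M R) \<and>
     (\<forall>K \<in> classes M. population G K \<le> class_up M K) \<and>
     extra_part M G"

definition sat_attr :: "bounded_spec \<Rightarrow> oid valuation \<Rightarrow> config \<Rightarrow> bool" where
  "sat_attr M \<rho> G \<longleftrightarrow> (\<forall>x \<in># G.
     sat \<rho> (on_create M (class_of x) (ident x)) \<and>
     (\<forall>R X. refs x R = Some X \<longrightarrow> sat \<rho> (on_set_ref M (class_of x) R (ident x) X)))"

definition instances :: "bounded_spec \<Rightarrow> (config \<times> oid valuation) set" where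
  "instances M = {(G, \<rho>). respects_bounds M G \<and> inv_part M G \<and> inv_full M G \<and> sat_attr M \<rho> G}"


section \<open>Runtime states and rewrite steps\<close>

datatype phase = ObjectBuild | RefBuild

datatype task = RefIdx oid role cls nat int

text \<open>An element of the multiset \<open>\<C>\<close>: an object record or a control token.\<close>

datatype item =
    Object obj
  | Phase phase
  | AllIds "oid list"
  | FreshIds "oid list"
  | TakenIds "oid list"
  | Missing cls nat
  | Need cls nat
  | RefPool "task list"

type_synonym state = "item multiset \<times> oid bexp"

definition objects :: "item multiset \<Rightarrow> config" where
  "objects C = image_mset (\<lambda>t. case t of Object x \<Rightarrow> x)
     (filter_mset (\<lambda>t. case t of Object x \<Rightarrow> True | _ \<Rightarrow> False) C)"

definition denotation :: "state \<Rightarrow> (config \<times> oid valuation) set" where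
  "denotation S = {(objects (fst S), \<rho>) | \<rho>. sat \<rho> (snd S)}"

definition alloc_list :: "bounded_spec \<Rightarrow> oid list" where
  "alloc_list M = concat (map (\<lambda>K. map (Oid K) [0..<class_up M K]) (class_list (schema M)))"

definition in_need :: "bounded_spec \<Rightarrow> cls \<Rightarrow> nat" where
  "in_need M K = Max (insert 0 {role_lo M R | R. R \<in> set (role_list (schema M)) \<and> tgt (schema M) R = K})"

definition init_find :: "bounded_spec \<Rightarrow> state" where
  "init_find M =
     ({#Phase ObjectBuild, AllIds (alloc_list M), FreshIds (alloc_list M), TakenIds [], RefPool []#}
        + mset (map (\<lambda>K. Missing K (class_lo M K)) (class_list (schema M)))
        + mset (map (\<lambda>K. Need K (in_need M K)) (class_list (schema M))),
      BConst True)"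

text \<open>The sublists of length \<open>m\<close>, in the lexicographic order of positions.\<close>

fun combinations :: "nat \<Rightarrow> 'a list \<Rightarrow> 'a list list" where
  "combinations 0 xs = [[]]"
| "combinations (Suc m) [] = []"
| "combinations (Suc m) (x # xs) = map ((#) x) (combinations m xs) @ combinations (Suc m) xs"

text \<open>The enumeration of the reference sets for role \<open>R\<close> with target class \<open>K'\<close>, where \<open>us\<close> is the
  identifier universe.\<close>

definition ref_domain :: "bounded_spec \<Rightarrow> role \<Rightarrow> cls \<Rightarrow> oid list \<Rightarrow> oid set list" where
  "ref_domain M R K' us =
     (let targets = filter (\<lambda>i. subcls (schema M) (oid_class i) K') us
      in concat (map (\<lambda>m. map set (combinations m targets)) [role_lo M R..<Suc (role_up M R)]))"

text \<open>A task gets its counters when the reference phase starts, since the targets are not known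
  before.  \<open>REM\<close> is an integer: it is \<open>-1\<close> if there is no admissible reference set.\<close>

fun start_task :: "bounded_spec \<Rightarrow> oid list \<Rightarrow> task \<Rightarrow> task" where
  "start_task M us (RefIdx x R K' _ _) = RefIdx x R K' 0 (int (length (ref_domain M R K' us)) - 1)"

text \<open>\<open>fires M C h C'\<close>: some rule rewrites \<open>C\<close> to \<open>C'\<close> and contributes the constraint \<open>h\<close>.  The
  variable \<open>X\<close> is the rest of the multiset.  Lists, natural numbers and sets are values, so every
  right-hand side is already in normal form with respect to the equations.\<close>

inductive fires :: "bounded_spec \<Rightarrow> item multiset \<Rightarrow> oid bexp \<Rightarrow> item multiset \<Rightarrow> bool"
  for M :: bounded_spec
where
  Obj_Gen:
    "K = oid_class x \<Longrightarrow>
     fires M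
      ({#Phase ObjectBuild, FreshIds (x # xs), TakenIds ts, Missing K m, Need K n, RefPool ps#} + X)
      (on_create M K x)
      ({#Phase ObjectBuild, FreshIds xs, TakenIds (ts @ [x]), Missing K (m - 1), Need K (n - 1),
         RefPool (ps @ map (\<lambda>R. RefIdx x R (tgt (schema M) R) 0 0) (roles_of (schema M) K)),
         Object (Obj x K (placeholders (schema M) K x) Map.empty)#} + X)"
| Obj_Skip:
    "K = oid_class x \<Longrightarrow>
     fires M
      ({#Phase ObjectBuild, FreshIds (x # xs), Missing K 0, Need K 0#} + X)
      (BConst True)
      ({#Phase ObjectBuild, FreshIds xs, Missing K 0, Need K 0#} + X)"
| Ref_Start:
    "fires M
      ({#Phase ObjectBuild, AllIds us, FreshIds [], TakenIds ts, RefPool ps#} + X)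
      (BConst True)
      ({#Phase RefBuild, AllIds ts, FreshIds [], TakenIds ts, RefPool (map (start_task M ts) ps)#} + X)"
| Ref_Choose:
    "c < length (ref_domain M R K' us) \<Longrightarrow> v = ref_domain M R K' us ! c \<Longrightarrow>
     fires M
      ({#Phase RefBuild, AllIds us, RefPool (RefIdx x R K' c r # ps), Object (Obj x K A F)#} + X)
      (on_set_ref M K R x v)
      ({#Phase RefBuild, AllIds us, RefPool ps, Object (Obj x K A (F(R \<mapsto> v)))#} + X)"
| Ref_Skip:
    "r > 0 \<Longrightarrow>
     fires M
      ({#Phase RefBuild, RefPool (RefIdx x R K' c r # ps)#} + X)
      (BConst True)
      ({#Phase RefBuild, RefPool (RefIdx x R K' (c + 1) (r - 1) # ps)#} + X)"

inductive step :: "bounded_spec \<Rightarrow> (oid bexp \<Rightarrow> oid bexp) \<Rightarrow> state \<Rightarrow> state \<Rightarrow> bool"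
  for M :: bounded_spec and simpB :: "oid bexp \<Rightarrow> oid bexp"
where
  "fires M C h C' \<Longrightarrow> step M simpB (C, \<phi>) (C', simpB (BAnd \<phi> h))"

definition reachable :: "bounded_spec \<Rightarrow> (oid bexp \<Rightarrow> oid bexp) \<Rightarrow> state \<Rightarrow> bool" where
  "reachable M simpB S \<longleftrightarrow> (step M simpB)\<^sup>*\<^sup>* (init_find M) S"

definition normal_form :: "bounded_spec \<Rightarrow> (oid bexp \<Rightarrow> oid bexp) \<Rightarrow> state \<Rightarrow> bool" where
  "normal_form M simpB S \<longleftrightarrow> (\<nexists>S'. step M simpB S S')"

definition accept_find :: "bounded_spec \<Rightarrow> (oid bexp \<Rightarrow> oid bexp) \<Rightarrow> state \<Rightarrow> bool" where
  "accept_find M simpB S \<longleftrightarrow>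
     normal_form M simpB S \<and> inv_part M (objects (fst S)) \<and> satisfiable (snd S) \<and>
     inv_full M (objects (fst S))"


section \<open>Subsumption and retention\<close>

text \<open>The attribute terms of runtime objects are attribute symbols, hence the following says that the
  domain of \<open>\<sigma>\<close> consists of symbols that occur in \<open>G\<close>, as for a substitution found by matching.\<close>

definition subst_on :: "oid substitution \<Rightarrow> config \<Rightarrow> bool" where
  "subst_on \<sigma> G \<longleftrightarrow>
     (\<forall>i a. isub \<sigma> i a \<noteq> ISym i a \<longrightarrow> (\<exists>x \<in># G. ident x = i \<and> atts x a = Some (symbol SInt i a))) \<and>
     (\<forall>i a. rsub \<sigma> i a \<noteq> RSym i a \<longrightarrow> (\<exists>x \<in># G. ident x = i \<and> atts x a = Some (symbol SReal i a))) \<and>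
     (\<forall>i a. bsub \<sigma> i a \<noteq> BSym i a \<longrightarrow> (\<exists>x \<in># G. ident x = i \<and> atts x a = Some (symbol SBool i a)))"

fun subst_aval :: "'o substitution \<Rightarrow> 'o aval \<Rightarrow> 'o aval" where
  "subst_aval \<sigma> (AInt t) = AInt (subst_i \<sigma> t)"
| "subst_aval \<sigma> (AReal t) = AReal (subst_r \<sigma> t)"
| "subst_aval \<sigma> (ABool t) = ABool (subst_b \<sigma> t)"

fun subst_obj :: "oid substitution \<Rightarrow> obj \<Rightarrow> obj" where
  "subst_obj \<sigma> (Obj x K A F) = Obj x K (\<lambda>a. map_option (subst_aval \<sigma>) (A a)) F"

definition subsumption_witness :: "(state \<Rightarrow> 'k) \<Rightarrow> state \<Rightarrow> state \<Rightarrow> bool" where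
  "subsumption_witness shape S1 S2 \<longleftrightarrow>
     shape S1 = shape S2 \<and>
     (\<exists>\<sigma>. subst_on \<sigma> (objects (fst S1)) \<and>
          objects (fst S2) = image_mset (subst_obj \<sigma>) (objects (fst S1)) \<and>
          entails (snd S2) (subst_b \<sigma> (snd S1)))"

definition accepted :: "bounded_spec \<Rightarrow> (oid bexp \<Rightarrow> oid bexp) \<Rightarrow> state set" where
  "accepted M simpB = {S. reachable M simpB S \<and> accept_find M simpB S}"

text \<open>\<open>search M simpB subsumes E A\<close>: after having explored the accepted normal forms \<open>E\<close>, in some
  order, the engine holds the antichain \<open>A\<close>.  The search is complete when \<open>E = accepted M simpB\<close>;
  the members of the final \<open>A\<close> are the retained states.  A subsumed candidate may, but need not, be
  discarded.\<close>

inductive search :: "bounded_spec \<Rightarrow> (oid bexp \<Rightarrow> oid bexp) \<Rightarrow> (state \<Rightarrow> state \<Rightarrow> bool) \<Rightarrow>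
    state set \<Rightarrow> state set \<Rightarrow> bool"
  for M :: bounded_spec and simpB :: "oid bexp \<Rightarrow> oid bexp" and subsumes :: "state \<Rightarrow> state \<Rightarrow> bool"
where
  start: "search M simpB subsumes {} {}"
| discard: "search M simpB subsumes E A \<Longrightarrow> S \<in> accepted M simpB \<Longrightarrow> T \<in> A \<Longrightarrow> subsumes T S \<Longrightarrow>
    search M simpB subsumes (insert S E) A"
| retain: "search M simpB subsumes E A \<Longrightarrow> S \<in> accepted M simpB \<Longrightarrow>
    search M simpB subsumes (insert S E) (insert S {T \<in> A. \<not> subsumes S T})"


section \<open>Choice of object identifiers\<close>

text \<open>The number of objects of class \<open>K\<close> that every exhaustion of the allocation list creates: before,
  the identifiers of \<open>K\<close> cannot be skipped.\<close>

definition mandatory :: "bounded_spec \<Rightarrow> cls \<Rightarrow> nat" where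
  "mandatory M K = min (class_up M K) (max (class_lo M K) (in_need M K))"

definition canonically_named :: "bounded_spec \<Rightarrow> config \<Rightarrow> bool" where
  "canonically_named M G \<longleftrightarrow>
     idents G \<subseteq> set (alloc_list M) \<and>
     (\<forall>K \<in> classes M. \<forall>n < mandatory M K. Oid K n \<in> idents G)"

definition renaming :: "(oid \<Rightarrow> oid) \<Rightarrow> bool" where
  "renaming f \<longleftrightarrow> bij f \<and> (\<forall>i. oid_class (f i) = oid_class i)"

fun rename_obj :: "(oid \<Rightarrow> oid) \<Rightarrow> obj \<Rightarrow> obj" where
  "rename_obj f (Obj x K A F) =
     Obj (f x) K (\<lambda>a. map_option (map_aval f) (A a)) (\<lambda>R. map_option ((`) f) (F R))"

definition rename_config :: "(oid \<Rightarrow> oid) \<Rightarrow> config \<Rightarrow> config" where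
  "rename_config f G = image_mset (rename_obj f) G"

definition rename_valuation :: "(oid \<Rightarrow> oid) \<Rightarrow> oid valuation \<Rightarrow> oid valuation" where
  "rename_valuation f \<rho> =
     \<lparr>ival = (\<lambda>i. ival \<rho> (inv f i)), rval = (\<lambda>i. rval \<rho> (inv f i)), bval = (\<lambda>i. bval \<rho> (inv f i))\<rparr>"

text \<open>The user-supplied parts of the specification do not depend on the choice of identifiers.\<close>

definition name_independent :: "bounded_spec \<Rightarrow> bool" where
  "name_independent M \<longleftrightarrow> (\<forall>f. renaming f \<longrightarrow>
     (\<forall>G. extra_part M (rename_config f G) = extra_part M G) \<and>
     (\<forall>G. inv_full M (rename_config f G) = inv_full M G) \<and>
     (\<forall>K i \<rho>. sat (rename_valuation f \<rho>) (on_create M K (f i)) = sat \<rho> (on_create M K i)) \<and>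
     (\<forall>K R i X \<rho>. sat (rename_valuation f \<rho>) (on_set_ref M K R (f i) (f ` X)) =
        sat \<rho> (on_set_ref M K R i X)))"

end

theory Submission
  imports Defs "HOL-Library.Infinite_Set"
begin

text \<open>An instance with canonical names is reached by the run that creates exactly its objects and
  skips every task to the index of the reference set in the instance; the valuation satisfies each
  constraint on the way.  An identifier is only skipped when its class has no open demand, since the
  first \<open>mandatory\<close> identifiers of the class precede it and belong to the instance.  A state that
  subsumes another one covers it, because both consist of placeholders and the matching
  substitution is therefore the identity; hence discarding and evicting preserve coverage.  An
  arbitrary instance is first renamed so that the objects of each class occupy an initial segment of
  its identifiers.\<close>

section \<open>Retained states cover the accepted ones\<close>

lemma Object_in_iff: "y \<in># objects C \<longleftrightarrow> Object y \<in># C"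
proof
  assume "y \<in># objects C"
  then show "Object y \<in># C"
    by (auto simp: objects_def split: item.splits)
next
  assume "Object y \<in># C"
  then have "Object y \<in> {t. t \<in># C \<and> (case t of Object x \<Rightarrow> True | _ \<Rightarrow> False)}" by simp
  then show "y \<in># objects C" by (force simp: objects_def image_iff)
qed

text \<open>Invariant of every run: attributes stay symbolic, which later forces a matching
  substitution to be trivial.\<close>

definition has_placeholders :: "schema \<Rightarrow> config \<Rightarrow> bool" where
  "has_placeholders \<S> G \<longleftrightarrow> (\<forall>x \<in># G. atts x = placeholders \<S> (class_of x) (ident x))"

lemma has_placeholders_objects:
  "has_placeholders \<S> (objects C) \<longleftrightarrow>
     (\<forall>x. Object x \<in># C \<longrightarrow> atts x = placeholders \<S> (class_of x) (ident x))"
  by (auto simp: has_placeholders_def Object_in_iff)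

lemma fires_has_placeholders:
  assumes "fires M C h C'" "has_placeholders (schema M) (objects C)"
  shows "has_placeholders (schema M) (objects C')"
  using assms unfolding has_placeholders_objects by cases auto

lemma reachable_has_placeholders:
  assumes "reachable M simpB S"
  shows "has_placeholders (schema M) (objects (fst S))"
  using assms unfolding reachable_def
proof (induction rule: rtranclp_induct)
  case base
  show ?case by (auto simp: has_placeholders_objects init_find_def)
next
  case (step S S')
  from step.hyps(2) show ?case
    by cases (use step.IH in \<open>auto dest: fires_has_placeholders\<close>)
qed

lemma subst_id:
  assumes "isub \<sigma> = ISym" "rsub \<sigma> = RSym" "bsub \<sigma> = BSym"
  shows "subst_i \<sigma> s = s" "subst_r \<sigma> u = u" "subst_b \<sigma> p = p"
  by (induction s and u and p) (simp_all add: assms)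

text \<open>A symbol moved by \<sigma> occurs in some object of \<open>G1\<close>. The image of that
  object lies in \<open>G2\<close> with the same identifier and class, so it carries the same
  placeholders and \<sigma> fixes the symbol after all.\<close>

lemma subst_on_trivial:
  assumes on: "subst_on \<sigma> G1" and img: "G2 = image_mset (subst_obj \<sigma>) G1"
    and p1: "has_placeholders \<S> G1" and p2: "has_placeholders \<S> G2"
  shows "isub \<sigma> = ISym" "rsub \<sigma> = RSym" "bsub \<sigma> = BSym"
proof -
  have fixed: "subst_aval \<sigma> (symbol s i a) = symbol s i a"
    if x: "x \<in># G1" "ident x = i" "atts x a = Some (symbol s i a)" for x s i a
  proof -
    have "subst_obj \<sigma> x \<in># G2" using x img by auto
    then have "atts (subst_obj \<sigma> x)
        = placeholders \<S> (class_of (subst_obj \<sigma> x)) (ident (subst_obj \<sigma> x))"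
      using p2 by (auto simp: has_placeholders_def)
    moreover have "atts x = placeholders \<S> (class_of x) (ident x)"
      using p1 x by (auto simp: has_placeholders_def)
    ultimately have "map_option (subst_aval \<sigma>) (atts x a) = atts x a"
      by (cases x) (auto dest: fun_cong)
    then show ?thesis using x by simp
  qed
  show "isub \<sigma> = ISym"
  proof (intro ext, rule ccontr)
    fix i a
    assume "isub \<sigma> i a \<noteq> ISym i a"
    moreover from this obtain x where "x \<in># G1" "ident x = i" "atts x a = Some (symbol SInt i a)"
      using on unfolding subst_on_def by blast
    ultimately show False using fixed[of x i a SInt] by simp
  qed
  show "rsub \<sigma> = RSym"
  proof (intro ext, rule ccontr)
    fix i a
    assume "rsub \<sigma> i a \<noteq> RSym i a"
    moreover from this obtain x where "x \<in># G1" "ident x = i" "atts x a = Some (symbol SReal i a)"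
      using on unfolding subst_on_def by blast
    ultimately show False using fixed[of x i a SReal] by simp
  qed
  show "bsub \<sigma> = BSym"
  proof (intro ext, rule ccontr)
    fix i a
    assume "bsub \<sigma> i a \<noteq> BSym i a"
    moreover from this obtain x where "x \<in># G1" "ident x = i" "atts x a = Some (symbol SBool i a)"
      using on unfolding subst_on_def by blast
    ultimately show False using fixed[of x i a SBool] by simp
  qed
qed

lemma subst_obj_id:
  assumes "isub \<sigma> = ISym" "rsub \<sigma> = RSym" "bsub \<sigma> = BSym"
  shows "subst_obj \<sigma> x = x"
proof -
  have "subst_aval \<sigma> v = v" for v
    by (cases v) (simp_all add: subst_id[OF assms])
  then have "subst_aval \<sigma> = id" by auto
  then show ?thesis by (cases x) (simp add: option.map_id)
qed

text \<open>The matching substitution is the identity, so the witness reduces to equal objects and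
  entailment between the original constraints.\<close>

lemma subsumption_witness_denotation:
  assumes w: "subsumption_witness shape S1 S2"
    and "reachable M simpB S1" "reachable M simpB S2"
  shows "denotation S2 \<subseteq> denotation S1"
proof -
  obtain \<sigma> where on: "subst_on \<sigma> (objects (fst S1))"
    and img: "objects (fst S2) = image_mset (subst_obj \<sigma>) (objects (fst S1))"
    and ent: "entails (snd S2) (subst_b \<sigma> (snd S1))"
    using w by (auto simp: subsumption_witness_def)
  note id = subst_on_trivial[OF on img assms(2,3)[THEN reachable_has_placeholders]]
  have "subst_obj \<sigma> = id" using subst_obj_id[OF id] by auto
  then have "objects (fst S2) = objects (fst S1)"
    using img by simp
  moreover have "entails (snd S2) (snd S1)"
    using ent subst_id(3)[OF id] by simp
  ultimately show ?thesis by (auto simp: denotation_def entails_def)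
qed

section \<open>Coverage by the antichain\<close>

text \<open>Covering is inclusion of denotations, hence transitive.
  \<open>E \<subseteq> accepted M simpB\<close> is carried through the induction because the
  inclusion for a subsumed state is derived for reachable states.\<close>

lemma search_covers:
  assumes "search M simpB subsumes E A"
    and sound: "\<And>S1 S2. subsumes S1 S2 \<Longrightarrow> subsumption_witness shape S1 S2"
  shows "A \<subseteq> E \<and> E \<subseteq> accepted M simpB \<and> (\<forall>S \<in> E. \<exists>T \<in> A. denotation S \<subseteq> denotation T)"
proof -
  have incl: "denotation S2 \<subseteq> denotation S1"
    if "subsumes S1 S2" "S1 \<in> accepted M simpB" "S2 \<in> accepted M simpB" for S1 S2
    using subsumption_witness_denotation[OF sound[OF that(1)], of M simpB] that(2,3)
    by (simp add: accepted_def)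
  from assms(1) show ?thesis
  proof induction
    case start
    then show ?case by simp
  next
    case (discard E A S T)
    then have "denotation S \<subseteq> denotation T" by (intro incl) auto
    with discard show ?case by blast
  next
    case (retain E A S)
    \<comment> \<open>If the state \<open>T\<close> that covers \<open>U\<close> is evicted by
      \<open>S\<close>, then \<open>S\<close> covers \<open>T\<close> and thereby
      \<open>U\<close>.\<close>
    have "\<exists>T' \<in> insert S {T \<in> A. \<not> subsumes S T}. denotation U \<subseteq> denotation T'" if "U \<in> E" for U
    proof -
      from retain.IH that obtain T where T: "T \<in> A" "denotation U \<subseteq> denotation T" by blast
      show ?thesis
      proof (cases "subsumes S T")
        case True
        then have "denotation T \<subseteq> denotation S"
          using retain T by (intro incl) auto
        with T show ?thesis by blast
      qed (use T in blast)
    qed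
    with retain show ?case by blast
  qed
qed


section \<open>Runs along a satisfying valuation\<close>

text \<open>The valuation is fixed before the run, so only the multiset has to be followed and the
  growing constraint drops out of the state.\<close>

definition fires_sat :: "bounded_spec \<Rightarrow> oid valuation \<Rightarrow> item multiset \<Rightarrow> item multiset \<Rightarrow> bool"
  where "fires_sat M \<rho> C C' \<longleftrightarrow> (\<exists>h. fires M C h C' \<and> sat \<rho> h)"

text \<open>Each contributed constraint is true under \<rho> and \<open>simpB\<close> preserves
  truth, so the accumulated conjunction stays true.\<close>

lemma fires_sat_steps:
  assumes "(fires_sat M \<rho>)\<^sup>*\<^sup>* C C'" and simp_sound: "\<And>\<psi>. sat \<rho> (simpB \<psi>) = sat \<rho> \<psi>"
    and "sat \<rho> \<phi>"
  shows "\<exists>\<phi>'. (step M simpB)\<^sup>*\<^sup>* (C, \<phi>) (C', \<phi>') \<and> sat \<rho> \<phi>'"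
  using assms(1)
proof induction
  case base
  with assms(3) show ?case by blast
next
  case (step D D')
  then obtain \<phi>' h where "(step M simpB)\<^sup>*\<^sup>* (C, \<phi>) (D, \<phi>')" "sat \<rho> \<phi>'" "fires M D h D'" "sat \<rho> h"
    by (auto simp: fires_sat_def)
  then have "(step M simpB)\<^sup>*\<^sup>* (C, \<phi>) (D', simpB (BAnd \<phi>' h))" "sat \<rho> (simpB (BAnd \<phi>' h))"
    by (auto intro: rtranclp.rtrancl_into_rtrancl step.intros simp: simp_sound)
  then show ?case by blast
qed

text \<open>The object rules and the phase switch require \<open>Phase ObjectBuild\<close>; the two
  remaining rules require a task at the head of the pool.\<close>

lemma normal_form_if_no_task:
  assumes "\<And>p. Phase p \<in># C \<Longrightarrow> p = RefBuild" "\<And>ps. RefPool ps \<in># C \<Longrightarrow> ps = []"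
  shows "normal_form M simpB (C, \<phi>)"
proof -
  have "\<not> fires M C h C'" for h C'
  proof
    assume "fires M C h C'"
    then have "Phase ObjectBuild \<in># C \<or> (\<exists>t ps. RefPool (t # ps) \<in># C)"
      by cases auto
    with assms show False by fastforce
  qed
  then show ?thesis by (auto simp: normal_form_def elim: step.cases)
qed

section \<open>Configurations of the two phases in closed form, and single steps between
  them\<close>

text \<open>Truncated subtraction models the saturating decrement, so the counters depend only on
  how many objects of each class exist.\<close>

definition counters :: "bounded_spec \<Rightarrow> (cls \<Rightarrow> nat) \<Rightarrow> item multiset" where
  "counters M cnt =
     mset (map (\<lambda>K. Missing K (class_lo M K - cnt K)) (class_list (schema M))) +
     mset (map (\<lambda>K. Need K (in_need M K - cnt K)) (class_list (schema M)))"

definition class_count :: "oid list \<Rightarrow> cls \<Rightarrow> nat" where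
  "class_count ts K = length (filter (\<lambda>i. oid_class i = K) ts)"

definition runtime_obj :: "bounded_spec \<Rightarrow> (oid \<Rightarrow> role \<Rightarrow> oid set option) \<Rightarrow> oid \<Rightarrow> obj" where
  "runtime_obj M F x = Obj x (oid_class x) (placeholders (schema M) (oid_class x) x) (F x)"

definition runtime_objs ::
    "bounded_spec \<Rightarrow> (oid \<Rightarrow> role \<Rightarrow> oid set option) \<Rightarrow> oid list \<Rightarrow> item multiset" where
  "runtime_objs M F ts = mset (map (\<lambda>x. Object (runtime_obj M F x)) ts)"

text \<open>The order is that of the task pool: objects by creation, then roles by
  declaration.\<close>

definition ref_pairs :: "bounded_spec \<Rightarrow> oid list \<Rightarrow> (oid \<times> role) list" where
  "ref_pairs M ts = concat (map (\<lambda>x. map (Pair x) (roles_of (schema M) (oid_class x))) ts)"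

definition task_of :: "bounded_spec \<Rightarrow> oid \<times> role \<Rightarrow> task" where
  "task_of M = (\<lambda>(x, R). RefIdx x R (tgt (schema M) R) 0 0)"

text \<open>\<open>ts\<close> holds the created identifiers and \<open>xs\<close> the unread rest of
  the allocation list; skipped identifiers leave no trace.\<close>

definition obj_state :: "bounded_spec \<Rightarrow> oid list \<Rightarrow> oid list \<Rightarrow> item multiset" where
  "obj_state M ts xs =
     {#Phase ObjectBuild, AllIds (alloc_list M), FreshIds xs, TakenIds ts,
       RefPool (map (task_of M) (ref_pairs M ts))#} +
     counters M (class_count ts) + runtime_objs M (\<lambda>_. Map.empty) ts"

definition ref_state ::
    "bounded_spec \<Rightarrow> oid list \<Rightarrow> task list \<Rightarrow> (oid \<Rightarrow> role \<Rightarrow> oid set option) \<Rightarrow> item multiset" where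
  "ref_state M ts ps F =
     {#Phase RefBuild, AllIds ts, FreshIds [], TakenIds ts, RefPool ps#} +
     counters M (class_count ts) + runtime_objs M F ts"

lemma init_find_obj_state: "init_find M = (obj_state M [] (alloc_list M), BConst True)"
  by (simp add: init_find_def obj_state_def counters_def class_count_def runtime_objs_def
      ref_pairs_def ac_simps)

lemma mset_map_split:
  assumes "K \<in> set Ks"
  shows "mset (map g Ks) = add_mset (g K) (mset (map g (remove1 K Ks)))"
  using assms by (induction Ks) auto

text \<open>The remainder \<open>X\<close> does not depend on \<open>cnt'\<close>, so the same
  \<open>X\<close> serves as rule context before and after a step that changes only the count of
  \<open>K\<close>.\<close>

lemma counters_split:
  assumes "K \<in> classes M" "distinct (class_list (schema M))"
  shows "\<exists>X. \<forall>cnt'. (\<forall>K'. K' \<noteq> K \<longrightarrow> cnt' K' = cnt K') \<longrightarrow>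
    counters M cnt' = {#Missing K (class_lo M K - cnt' K), Need K (in_need M K - cnt' K)#} + X"
proof (intro exI allI impI)
  fix cnt' assume same: "\<forall>K'. K' \<noteq> K \<longrightarrow> cnt' K' = cnt K'"
  let ?Ks = "remove1 K (class_list (schema M))"
  \<comment> \<open>The class list is distinct, so removing \<open>K\<close> once removes it
    altogether and the counts agree on the rest.\<close>
  have eqs: "map (\<lambda>K. Missing K (class_lo M K - cnt' K)) ?Ks
      = map (\<lambda>K. Missing K (class_lo M K - cnt K)) ?Ks"
    "map (\<lambda>K. Need K (in_need M K - cnt' K)) ?Ks = map (\<lambda>K. Need K (in_need M K - cnt K)) ?Ks"
    using same assms(2) by auto
  show "counters M cnt' = {#Missing K (class_lo M K - cnt' K), Need K (in_need M K - cnt' K)#} +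
     (mset (map (\<lambda>K. Missing K (class_lo M K - cnt K)) ?Ks) +
      mset (map (\<lambda>K. Need K (in_need M K - cnt K)) ?Ks))"
    unfolding counters_def mset_map_split[OF assms(1), of "\<lambda>K. Missing K (class_lo M K - cnt' K)"]
      mset_map_split[OF assms(1), of "\<lambda>K. Need K (in_need M K - cnt' K)"] eqs
    by (simp only: union_mset_add_mset_left union_mset_add_mset_right add_mset_add_mset_same_iff
        add_mset_commute add_0)
qed

lemma fires_gen:
  assumes "oid_class x \<in> classes M" "distinct (class_list (schema M))"
  shows "fires M (obj_state M ts (x # xs)) (on_create M (oid_class x) x) (obj_state M (ts @ [x]) xs)"
proof -
  let ?K = "oid_class x"
  obtain X where X: "\<And>cnt'. (\<And>K'. K' \<noteq> ?K \<Longrightarrow> cnt' K' = class_count ts K') \<Longrightarrow>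
    counters M cnt' = {#Missing ?K (class_lo M ?K - cnt' ?K), Need ?K (in_need M ?K - cnt' ?K)#} + X"
    using counters_split[OF assms, of "class_count ts"] by blast
  have 1: "counters M (class_count ts) = {#Missing ?K (class_lo M ?K - class_count ts ?K),
      Need ?K (in_need M ?K - class_count ts ?K)#} + X"
    by (rule X) simp
  \<comment> \<open>One more object of the class lowers both counters by one, as
    \<open>a - (c + 1) = a - c - 1\<close> holds for truncated subtraction too.\<close>
  have 2: "counters M (class_count (ts @ [x])) = {#Missing ?K (class_lo M ?K - class_count ts ?K - 1),
      Need ?K (in_need M ?K - class_count ts ?K - 1)#} + X"
    by (subst X) (auto simp: class_count_def)
  have "fires M
      ({#Phase ObjectBuild, FreshIds (x # xs), TakenIds ts, Missing ?K (class_lo M ?K - class_count ts ?K),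
         Need ?K (in_need M ?K - class_count ts ?K), RefPool (map (task_of M) (ref_pairs M ts))#}
        + (add_mset (AllIds (alloc_list M)) X + runtime_objs M (\<lambda>_. Map.empty) ts))
      (on_create M ?K x)
      ({#Phase ObjectBuild, FreshIds xs, TakenIds (ts @ [x]),
         Missing ?K (class_lo M ?K - class_count ts ?K - 1), Need ?K (in_need M ?K - class_count ts ?K - 1),
         RefPool (map (task_of M) (ref_pairs M ts) @
           map (\<lambda>R. RefIdx x R (tgt (schema M) R) 0 0) (roles_of (schema M) ?K)),
         Object (Obj x ?K (placeholders (schema M) ?K x) Map.empty)#}
        + (add_mset (AllIds (alloc_list M)) X + runtime_objs M (\<lambda>_. Map.empty) ts))"
    by (rule Obj_Gen) simp
  then show ?thesis
    unfolding obj_state_def 1 2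
    by (simp add: runtime_objs_def runtime_obj_def ref_pairs_def task_of_def comp_def add_mset_commute)
qed

lemma fires_skip:
  assumes "oid_class x \<in> classes M" "distinct (class_list (schema M))"
    and "class_lo M (oid_class x) \<le> class_count ts (oid_class x)"
    and "in_need M (oid_class x) \<le> class_count ts (oid_class x)"
  shows "fires M (obj_state M ts (x # xs)) (BConst True) (obj_state M ts xs)"
proof -
  let ?K = "oid_class x"
  obtain X where X: "\<And>cnt'. (\<And>K'. K' \<noteq> ?K \<Longrightarrow> cnt' K' = class_count ts K') \<Longrightarrow>
    counters M cnt' = {#Missing ?K (class_lo M ?K - cnt' ?K), Need ?K (in_need M ?K - cnt' ?K)#} + X"
    using counters_split[OF assms(1,2), of "class_count ts"] by blast
  have 1: "counters M (class_count ts) = {#Missing ?K 0, Need ?K 0#} + X"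
    by (subst X) (use assms in auto)
  have "fires M
      ({#Phase ObjectBuild, FreshIds (x # xs), Missing ?K 0, Need ?K 0#} +
        (X + {#AllIds (alloc_list M), TakenIds ts, RefPool (map (task_of M) (ref_pairs M ts))#}
           + runtime_objs M (\<lambda>_. Map.empty) ts)) (BConst True)
      ({#Phase ObjectBuild, FreshIds xs, Missing ?K 0, Need ?K 0#} +
        (X + {#AllIds (alloc_list M), TakenIds ts, RefPool (map (task_of M) (ref_pairs M ts))#}
           + runtime_objs M (\<lambda>_. Map.empty) ts))"
    by (rule Obj_Skip) simp
  then show ?thesis
    unfolding obj_state_def 1 by (simp add: add_mset_commute)
qed

lemma fires_ref_start:
  "fires M (obj_state M ts []) (BConst True)
     (ref_state M ts (map (start_task M ts \<circ> task_of M) (ref_pairs M ts)) (\<lambda>_. Map.empty))"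
proof -
  have "fires M
      ({#Phase ObjectBuild, AllIds (alloc_list M), FreshIds [], TakenIds ts,
         RefPool (map (task_of M) (ref_pairs M ts))#}
        + (counters M (class_count ts) + runtime_objs M (\<lambda>_. Map.empty) ts))
      (BConst True)
      ({#Phase RefBuild, AllIds ts, FreshIds [], TakenIds ts,
         RefPool (map (start_task M ts) (map (task_of M) (ref_pairs M ts)))#}
        + (counters M (class_count ts) + runtime_objs M (\<lambda>_. Map.empty) ts))"
    by (rule Ref_Start)
  then show ?thesis by (simp add: obj_state_def ref_state_def ac_simps)
qed

lemma fires_ref_skip:
  assumes "r > 0"
  shows "fires M (ref_state M ts (RefIdx x R K c r # ps) F) (BConst True)
     (ref_state M ts (RefIdx x R K (c + 1) (r - 1) # ps) F)"
proof -
  have "fires M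
      ({#Phase RefBuild, RefPool (RefIdx x R K c r # ps)#} +
        ({#AllIds ts, FreshIds [], TakenIds ts#} + counters M (class_count ts) + runtime_objs M F ts))
      (BConst True)
      ({#Phase RefBuild, RefPool (RefIdx x R K (c + 1) (r - 1) # ps)#} +
        ({#AllIds ts, FreshIds [], TakenIds ts#} + counters M (class_count ts) + runtime_objs M F ts))"
    by (rule Ref_Skip) fact
  then show ?thesis by (simp add: ref_state_def add_mset_commute)
qed

lemma fires_ref_choose:
  assumes "c < length (ref_domain M R K ts)" "ref_domain M R K ts ! c = v"
    and "x \<in> set ts" "distinct ts"
  shows "fires M (ref_state M ts (RefIdx x R K c r # ps) F) (on_set_ref M (oid_class x) R x v)
     (ref_state M ts ps (F(x := (F x)(R \<mapsto> v))))"
proof -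
  let ?F = "F(x := (F x)(R \<mapsto> v))"
  let ?X = "{#FreshIds [], TakenIds ts#} + counters M (class_count ts)
     + runtime_objs M F (remove1 x ts)"
  have split: "runtime_objs M F' ts
      = add_mset (Object (runtime_obj M F' x)) (runtime_objs M F' (remove1 x ts))" for F'
    unfolding runtime_objs_def by (rule mset_map_split) fact
  \<comment> \<open>\<open>x\<close> occurs only once in the distinct list \<open>ts\<close>, so the
    update at \<open>x\<close> alters a single object record.\<close>
  have rest: "runtime_objs M ?F (remove1 x ts) = runtime_objs M F (remove1 x ts)"
    unfolding runtime_objs_def
    by (rule arg_cong[where f = mset]) (use assms in \<open>auto simp: runtime_obj_def\<close>)
  have "fires M
      ({#Phase RefBuild, AllIds ts, RefPool (RefIdx x R K c r # ps), Object (runtime_obj M F x)#} + ?X)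
      (on_set_ref M (oid_class x) R x v)
      ({#Phase RefBuild, AllIds ts, RefPool ps, Object (runtime_obj M ?F x)#} + ?X)"
    unfolding runtime_obj_def fun_upd_same by (rule Ref_Choose) (use assms in auto)
  then show ?thesis
    unfolding ref_state_def split rest by (simp add: add_mset_commute)
qed

section \<open>Working through the reference tasks\<close>

text \<open>\<open>Ref_Skip\<close> is repeated up to an index of \<open>v\<close> in the
  enumeration, then \<open>Ref_Choose\<close> takes \<open>v\<close>.\<close>

lemma run_ref_task:
  assumes "v \<in> set (ref_domain M R K ts)" "x \<in> set ts" "distinct ts"
    and "sat \<rho> (on_set_ref M (oid_class x) R x v)"
  shows "(fires_sat M \<rho>)\<^sup>*\<^sup>* (ref_state M ts (start_task M ts (RefIdx x R K c0 r0) # ps) F)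
     (ref_state M ts ps (F(x := (F x)(R \<mapsto> v))))"
proof -
  let ?D = "ref_domain M R K ts"
  obtain n where n: "n < length ?D" "?D ! n = v"
    using assms(1) by (auto simp: in_set_conv_nth)
  \<comment> \<open>Along the skips \<open>curr + REM\<close> stays at the length of the enumeration
    minus one, so \<open>REM\<close> is positive at every index below \<open>n\<close> and skipping
    is enabled there.\<close>
  let ?st = "\<lambda>c. ref_state M ts (RefIdx x R K c (int (length ?D) - 1 - int c) # ps) F"
  have "(fires_sat M \<rho>)\<^sup>*\<^sup>* (?st 0) (?st c)" if "c \<le> n" for c
    using that
  proof (induction c)
    case (Suc c)
    have "fires M (?st c) (BConst True) (?st (Suc c))"
      using fires_ref_skip[of "int (length ?D) - 1 - int c" M ts x R K c ps F] Suc.prems n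
      by (simp add: algebra_simps)
    then have "fires_sat M \<rho> (?st c) (?st (Suc c))" by (force simp: fires_sat_def)
    with Suc show ?case by (meson Suc_leD rtranclp.rtrancl_into_rtrancl)
  qed simp
  moreover have "fires_sat M \<rho> (?st n) (ref_state M ts ps (F(x := (F x)(R \<mapsto> v))))"
    using fires_ref_choose[OF n assms(2,3)] assms(4) by (auto simp: fires_sat_def)
  ultimately have "(fires_sat M \<rho>)\<^sup>*\<^sup>* (?st 0) (ref_state M ts ps (F(x := (F x)(R \<mapsto> v))))"
    by (meson le_refl rtranclp.rtrancl_into_rtrancl)
  then show ?thesis by simp
qed

lemma run_ref_tasks:
  assumes "distinct ts"
    and "\<And>x R. (x, R) \<in> set prs \<Longrightarrow> x \<in> set ts \<and> V x R \<in> set (ref_domain M R (tgt (schema M) R) ts) \<and>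
      sat \<rho> (on_set_ref M (oid_class x) R x (V x R))"
  shows "(fires_sat M \<rho>)\<^sup>*\<^sup>* (ref_state M ts (map (start_task M ts \<circ> task_of M) prs) F)
     (ref_state M ts [] (\<lambda>x R. if (x, R) \<in> set prs then Some (V x R) else F x R))"
  using assms(2)
proof (induction prs arbitrary: F)
  case Nil
  show ?case by simp
next
  case (Cons p prs)
  obtain x R where p: "p = (x, R)" by (cases p)
  let ?F = "F(x := (F x)(R \<mapsto> V x R))"
  have task: "(fires_sat M \<rho>)\<^sup>*\<^sup>*
      (ref_state M ts (map (start_task M ts \<circ> task_of M) (p # prs)) F)
      (ref_state M ts (map (start_task M ts \<circ> task_of M) prs) ?F)"
  proof -
    have "x \<in> set ts" "V x R \<in> set (ref_domain M R (tgt (schema M) R) ts)"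
      "sat \<rho> (on_set_ref M (oid_class x) R x (V x R))"
      using Cons.prems[of x R] by (simp_all add: p)
    from run_ref_task[OF this(2,1) assms(1) this(3)] show ?thesis
      by (simp add: p task_of_def del: start_task.simps)
  qed
  have tasks: "(fires_sat M \<rho>)\<^sup>*\<^sup>* (ref_state M ts (map (start_task M ts \<circ> task_of M) prs) ?F)
      (ref_state M ts [] (\<lambda>x R. if (x, R) \<in> set prs then Some (V x R) else ?F x R))"
    by (rule Cons.IH) (use Cons.prems in auto)
  have eq: "(\<lambda>x R. if (x, R) \<in> set (p # prs) then Some (V x R) else F x R)
      = (\<lambda>x R. if (x, R) \<in> set prs then Some (V x R) else ?F x R)"
    by (intro ext) (simp add: p)
  show ?case unfolding eq by (rule rtranclp_trans[OF task tasks])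
qed

section \<open>Completeness of the enumeration of reference sets\<close>

text \<open>The recursion of \<open>combinations\<close> separates the sublists that take the head
  from those that do not; whether the head lies in \<open>Y\<close> decides which half contains
  \<open>Y\<close>.\<close>

lemma set_combinations:
  assumes "distinct xs" "Y \<subseteq> set xs"
  shows "Y \<in> set (map set (combinations (card Y) xs))"
  using assms
proof (induction "card Y" xs arbitrary: Y rule: combinations.induct)
  case (1 xs)
  then have "Y = {}" by (metis List.finite_set card_0_eq finite_subset)
  then show ?case by simp
next
  case (2 m)
  then show ?case by simp
next
  case (3 m x xs)
  show ?case
  proof (cases "x \<in> Y")
    case True
    have "finite Y" using 3 finite_subset by blast
    then have "m = card (Y - {x})" using 3(3) True by simp
    moreover have "Y - {x} \<subseteq> set xs" "distinct xs" using 3 by auto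
    ultimately have "Y - {x} \<in> set ` set (combinations m xs)"
      using 3(1)[of "Y - {x}"] by simp
    then obtain ys where "ys \<in> set (combinations m xs)" "set ys = Y - {x}" by auto
    then have "x # ys \<in> set (combinations (Suc m) (x # xs))" "set (x # ys) = Y" using True by auto
    then show ?thesis unfolding 3(3)[symmetric] by (metis image_eqI set_map)
  next
    case False
    then have "Y \<in> set (map set (combinations (card Y) xs))"
      using 3 by (intro 3(2)) auto
    then show ?thesis unfolding 3(3)[symmetric] by auto
  qed
qed

lemma ref_domain_complete:
  assumes "distinct us" "Y \<subseteq> {i \<in> set us. subcls (schema M) (oid_class i) K}"
    and "role_lo M R \<le> card Y" "card Y \<le> role_up M R"
  shows "Y \<in> set (ref_domain M R K us)"
proof -
  let ?ts = "filter (\<lambda>i. subcls (schema M) (oid_class i) K) us"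
  have "Y \<in> set (map set (combinations (card Y) ?ts))"
    using assms by (intro set_combinations) auto
  moreover have "card Y \<in> set [role_lo M R..<Suc (role_up M R)]" using assms by auto
  ultimately show ?thesis
    by (simp add: ref_domain_def image_iff del: upt_Suc set_upt) blast
qed


section \<open>Reaching a canonically named instance\<close>

lemma set_alloc_list: "Oid K n \<in> set (alloc_list M) \<longleftrightarrow> K \<in> classes M \<and> n < class_up M K"
proof -
  have "Oid K n \<in> Oid K' ` A \<longleftrightarrow> K' = K \<and> n \<in> A" for K' A by auto
  then show ?thesis by (auto simp: alloc_list_def)
qed

text \<open>Each class contributes one block with ascending indices; between blocks of different
  classes the condition is vacuous.\<close>

lemma alloc_list_sorted:
  assumes "distinct (class_list (schema M))"
  shows "sorted_wrt (\<lambda>i j. oid_class i = oid_class j \<longrightarrow> oid_index i < oid_index j) (alloc_list M)"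
proof -
  have "sorted_wrt (\<lambda>i j. oid_class i = oid_class j \<longrightarrow> oid_index i < oid_index j)
      (concat (map (\<lambda>K. map (Oid K) [0..<class_up M K]) Ks))" if "distinct Ks" for Ks
    using that by (induction Ks) (auto simp: sorted_wrt_append sorted_wrt_map)
  with assms show ?thesis by (simp add: alloc_list_def)
qed

lemma distinct_alloc_list:
  assumes "distinct (class_list (schema M))"
  shows "distinct (alloc_list M)"
proof -
  \<comment> \<open>The relation is irreflexive, so no element can recur.\<close>
  have "distinct xs"
    if "sorted_wrt (\<lambda>i j. oid_class i = oid_class j \<longrightarrow> oid_index i < oid_index j) xs" for xs
    using that by (induction xs) auto
  then show ?thesis using alloc_list_sorted[OF assms] by blast
qed

text \<open>The mandatory identifiers of a class come first in its block and all belong to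
  \<open>G\<close>. Hence they have been created before any identifier outside \<open>G\<close> is
  met, and both counters of the class are then zero.\<close>

lemma skippable:
  assumes "distinct (class_list (schema M))" "canonically_named M G"
    and split: "alloc_list M = ds @ x # xs" and "x \<notin> idents G"
  shows "max (class_lo M (oid_class x)) (in_need M (oid_class x))
    \<le> class_count (filter (\<lambda>i. i \<in> idents G) ds) (oid_class x)"
proof -
  obtain K n where x: "x = Oid K n" by (cases x)
  have "Oid K n \<in> set (alloc_list M)" using split x by simp
  then have K: "K \<in> classes M" "n < class_up M K" by (simp_all add: set_alloc_list)
  \<comment> \<open>With a smaller index \<open>x\<close> would be mandatory and thus belong to
    \<open>G\<close>.\<close>
  have mand: "mandatory M K \<le> n"
    using assms(2,4) K x by (force simp: canonically_named_def not_le[symmetric])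
  have "Oid K m \<in> set (filter (\<lambda>i. oid_class i = K) (filter (\<lambda>i. i \<in> idents G) ds))"
    if "m < mandatory M K" for m
  proof -
    have "Oid K m \<in> set (alloc_list M)" using that mand K by (simp add: set_alloc_list)
    moreover have "m < n" using that mand by simp
    \<comment> \<open>A position behind \<open>x\<close> would contradict \<open>m < n\<close>,
      because indices ascend within a class.\<close>
    moreover have "n < m" if "Oid K m \<in> set xs"
      using alloc_list_sorted[OF assms(1)] that unfolding split x by (auto simp: sorted_wrt_append)
    ultimately have "Oid K m \<in> set ds" unfolding split x by auto
    moreover have "Oid K m \<in> idents G"
      using assms(2) K that by (auto simp: canonically_named_def)
    ultimately show ?thesis by simp
  qed
  then have "Oid K ` {..<mandatory M K}
      \<subseteq> set (filter (\<lambda>i. oid_class i = K) (filter (\<lambda>i. i \<in> idents G) ds))" by blast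
  then have "card (Oid K ` {..<mandatory M K})
      \<le> length (filter (\<lambda>i. oid_class i = K) (filter (\<lambda>i. i \<in> idents G) ds))"
    by (meson List.finite_set card_length card_mono order_trans)
  moreover have "card (Oid K ` {..<mandatory M K}) = mandatory M K"
    by (simp add: card_image inj_on_def)
  \<comment> \<open>Since \<open>mandatory M K \<le> n < class_up M K\<close>, the minimum in
    \<open>mandatory\<close> is not the upper bound.\<close>
  moreover have "mandatory M K = max (class_lo M K) (in_need M K)"
    using mand K by (auto simp: mandatory_def)
  ultimately show ?thesis by (simp add: class_count_def x)
qed

lemma run_objects:
  assumes "distinct (class_list (schema M))" "canonically_named M G"
    and created: "\<And>i. i \<in> idents G \<Longrightarrow> sat \<rho> (on_create M (oid_class i) i)"
  shows "(fires_sat M \<rho>)\<^sup>*\<^sup>* (obj_state M [] (alloc_list M))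
     (obj_state M (filter (\<lambda>i. i \<in> idents G) (alloc_list M)) [])"
proof -
  let ?P = "\<lambda>i. i \<in> idents G"
  \<comment> \<open>Generalised to every split of the allocation list: the prefix \<open>ds\<close>
    records which identifiers were created, as the skipping condition requires.\<close>
  have "(fires_sat M \<rho>)\<^sup>*\<^sup>* (obj_state M (filter ?P ds) xs) (obj_state M (filter ?P (alloc_list M)) [])"
    if "alloc_list M = ds @ xs" for ds xs
    using that
  proof (induction xs arbitrary: ds)
    case (Cons x xs)
    have K: "oid_class x \<in> classes M"
      using Cons.prems set_alloc_list[of "oid_class x" "oid_index x" M] by simp
    have "fires_sat M \<rho> (obj_state M (filter ?P ds) (x # xs)) (obj_state M (filter ?P (ds @ [x])) xs)"
    proof (cases "?P x")
      case True
      with fires_gen[OF K assms(1)] created[OF True] show ?thesis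
        by (auto simp: fires_sat_def)
    next
      case False
      from skippable[OF assms(1,2) Cons.prems False] fires_skip[OF K assms(1)]
      have "fires M (obj_state M (filter ?P ds) (x # xs)) (BConst True) (obj_state M (filter ?P ds) xs)"
        by simp
      with False show ?thesis by (force simp: fires_sat_def)
    qed
    also have "(fires_sat M \<rho>)\<^sup>*\<^sup>* (obj_state M (filter ?P (ds @ [x])) xs)
        (obj_state M (filter ?P (alloc_list M)) [])"
      by (rule Cons.IH) (simp add: Cons.prems)
    finally show ?case .
  qed simp
  from this[of "[]"] show ?thesis by simp
qed

section \<open>Unique identifiers and the run to a canonical instance\<close>

lemma unique_ident:
  assumes "inv_part M G" "x \<in># G" "y \<in># G" "ident x = ident y"
  shows "x = y"
proof (rule ccontr)
  assume "x \<noteq> y"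
  then have "{#x, y#} \<subseteq># filter_mset (\<lambda>z. ident z = ident x) G"
    using assms by (auto simp: insert_subset_eq_iff in_diff_count)
  then have "2 \<le> size (filter_mset (\<lambda>z. ident z = ident x) G)"
    using size_mset_mono by fastforce
  moreover have "size (filter_mset (\<lambda>z. ident z = ident x) G) \<le> 1"
    using assms(1) by (simp add: inv_part_def)
  ultimately show False by simp
qed

lemma count_image_mset_size: "count (image_mset f G) i = size (filter_mset (\<lambda>x. f x = i) G)"
  by (induction G) auto

text \<open>At most one object per identifier bounds each multiplicity by one, so the multiset of
  identifiers is a set.\<close>

lemma image_ident:
  assumes "inv_part M G"
  shows "image_mset ident G = mset_set (idents G)"
proof (rule multiset_eqI)
  fix i
  define c where "c = count (image_mset ident G) i"
  have "c \<le> 1"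
    using assms unfolding c_def count_image_mset_size by (simp add: inv_part_def)
  moreover have "c = 0 \<longleftrightarrow> i \<notin> idents G"
    unfolding c_def count_eq_zero_iff by (auto simp: idents_def)
  moreover have "finite (idents G)" by (simp add: idents_def)
  ultimately have "c = count (mset_set (idents G)) i"
    by (cases "i \<in> idents G") auto
  then show "count (image_mset ident G) i = count (mset_set (idents G)) i" by (simp only: c_def)
qed

lemma objects_ref_state: "objects (ref_state M ts ps F) = image_mset (runtime_obj M F) (mset ts)"
proof -
  have "filter_mset (\<lambda>t. case t of Object x \<Rightarrow> True | _ \<Rightarrow> False) (counters M cnt) = {#}" for cnt
    by (auto simp: counters_def filter_mset_eq_mempty_iff)
  moreover have "objects (runtime_objs M F ts) = image_mset (runtime_obj M F) (mset ts)"
    by (induction ts) (auto simp: objects_def runtime_objs_def)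
  ultimately show ?thesis by (simp add: ref_state_def objects_def)
qed

lemma reach_canonical:
  assumes spec: "wf_spec M" and simp_sound: "\<And>\<rho>' \<phi>. sat \<rho>' (simpB \<phi>) = sat \<rho>' \<phi>"
    and inst: "(G, \<rho>) \<in> instances M" and canon: "canonically_named M G"
  shows "\<exists>S \<in> accepted M simpB. (G, \<rho>) \<in> denotation S"
proof -
  have dc: "distinct (class_list (schema M))"
    using spec by (simp add: wf_spec_def wf_schema_def)
  have bounds: "respects_bounds M G" and part: "inv_part M G" and full: "inv_full M G"
    and attr: "sat_attr M \<rho> G"
    using inst by (auto simp: instances_def)
  have obj: "oid_class (ident y) = class_of y"
    "atts y = placeholders (schema M) (class_of y) (ident y)"
    "dom (refs y) = set (roles_of (schema M) (class_of y))" if "y \<in># G" for y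
    using bounds that by (auto simp: respects_bounds_def respects_schema_def)
  define ts where "ts = filter (\<lambda>i. i \<in> idents G) (alloc_list M)"
  have ts: "set ts = idents G" "distinct ts"
    using canon distinct_alloc_list[OF dc] by (auto simp: ts_def canonically_named_def)
  define ob where "ob i = (THE y. y \<in># G \<and> ident y = i)" for i
  have ob: "ob (ident y) = y" if "y \<in># G" for y
    unfolding ob_def using that unique_ident[OF part] by (intro the_equality) auto
  define V where "V x R = the (refs (ob x) R)" for x R
  define F where "F = (\<lambda>x R. if (x, R) \<in> set (ref_pairs M ts) then Some (V x R) else None)"
  let ?C = "ref_state M ts [] F"

  \<comment> \<open>An object of \<open>G\<close> has a reference set for exactly the roles of its
    class, which are the roles that get a task.\<close>
  have pairs: "(ident y, R) \<in> set (ref_pairs M ts) \<longleftrightarrow> R \<in> dom (refs y)" if "y \<in># G" for y R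
  proof -
    have "(x, R) \<in> set (ref_pairs M ts) \<longleftrightarrow> x \<in> idents G \<and> R \<in> set (roles_of (schema M) (oid_class x))"
      for x
      by (auto simp: ref_pairs_def ts)
    then show ?thesis using that obj[OF that] by (simp add: idents_def)
  qed
  have same: "runtime_obj M F (ident y) = y" if y: "y \<in># G" for y
  proof -
    have "F (ident y) = refs y"
    proof
      fix R show "F (ident y) R = refs y R"
        by (cases "refs y R") (auto simp: F_def V_def ob[OF y] pairs[OF y])
    qed
    with obj[OF y] show ?thesis by (cases y) (simp add: runtime_obj_def)
  qed
  \<comment> \<open>\<open>ts\<close> enumerates the identifiers of \<open>G\<close> without
    repetition, and rebuilding an object from its identifier gives it back.\<close>
  have "objects ?C = image_mset (runtime_obj M F) (image_mset ident G)"
    using mset_set_set[OF ts(2)] by (simp only: objects_ref_state ts(1) image_ident[OF part])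
  also have "\<dots> = image_mset id G"
    unfolding multiset.map_comp by (rule image_mset_cong) (simp add: same)
  finally have objs: "objects ?C = G" by simp

  have "(fires_sat M \<rho>)\<^sup>*\<^sup>* (obj_state M [] (alloc_list M)) (obj_state M ts [])"
    unfolding ts_def
  proof (rule run_objects[OF dc canon])
    fix i assume "i \<in> idents G"
    then show "sat \<rho> (on_create M (oid_class i) i)"
      using attr obj by (auto simp: idents_def sat_attr_def)
  qed
  also have "fires_sat M \<rho> (obj_state M ts [])
      (ref_state M ts (map (start_task M ts \<circ> task_of M) (ref_pairs M ts)) (\<lambda>_. Map.empty))"
    using fires_ref_start by (force simp: fires_sat_def)
  also have "(fires_sat M \<rho>)\<^sup>*\<^sup>*
      (ref_state M ts (map (start_task M ts \<circ> task_of M) (ref_pairs M ts)) (\<lambda>_. Map.empty)) ?C"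
    unfolding F_def
  proof (rule run_ref_tasks[OF ts(2)])
    fix x R assume xR: "(x, R) \<in> set (ref_pairs M ts)"
    then have "x \<in> set ts" by (auto simp: ref_pairs_def)
    then obtain y where y: "y \<in># G" "x = ident y" by (auto simp: ts idents_def)
    with xR obtain X where X: "refs y R = Some X" using pairs by blast
    then have V: "V x R = X" by (simp add: V_def ob y)
    \<comment> \<open>The universe of the reference phase is the set of identifiers of
      \<open>G\<close>, so well-typed references are among the enumerated targets.\<close>
    have "X \<subseteq> {i \<in> set ts. subcls (schema M) (oid_class i) (tgt (schema M) R)}"
    proof
      fix i assume "i \<in> X"
      with bounds y X obtain z where "z \<in># G" "i = ident z" "subcls (schema M) (class_of z) (tgt (schema M) R)"
        unfolding respects_bounds_def respects_schema_def by blast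
      then show "i \<in> {i \<in> set ts. subcls (schema M) (oid_class i) (tgt (schema M) R)}"
        using obj by (auto simp: ts idents_def)
    qed
    moreover have "role_lo M R \<le> card X" "card X \<le> role_up M R"
      using bounds y X by (auto simp: respects_bounds_def)
    ultimately have "X \<in> set (ref_domain M R (tgt (schema M) R) ts)"
      by (intro ref_domain_complete ts(2))
    moreover have "sat \<rho> (on_set_ref M (oid_class x) R x X)"
      using attr y X obj by (auto simp: sat_attr_def)
    ultimately show "x \<in> set ts \<and> V x R \<in> set (ref_domain M R (tgt (schema M) R) ts) \<and>
        sat \<rho> (on_set_ref M (oid_class x) R x (V x R))"
      using \<open>x \<in> set ts\<close> V by simp
  qed
  finally have run: "(fires_sat M \<rho>)\<^sup>*\<^sup>* (obj_state M [] (alloc_list M)) ?C" .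
  obtain \<phi> where \<phi>: "reachable M simpB (?C, \<phi>)" "sat \<rho> \<phi>"
    using fires_sat_steps[OF run, of simpB "BConst True"] simp_sound
    by (auto simp: reachable_def init_find_obj_state)
  have "normal_form M simpB (?C, \<phi>)"
    by (rule normal_form_if_no_task)
       (auto simp: ref_state_def counters_def runtime_objs_def)
  then have "(?C, \<phi>) \<in> accepted M simpB"
    using \<phi> part full by (auto simp: accepted_def accept_find_def satisfiable_def objs)
  moreover have "(G, \<rho>) \<in> denotation (?C, \<phi>)"
    using \<phi> by (simp add: denotation_def objs)
  ultimately show ?thesis by blast
qed


section \<open>Renaming to canonical identifiers\<close>

lemma rename_obj_sel [simp]:
  "ident (rename_obj f x) = f (ident x)"
  "class_of (rename_obj f x) = class_of x"
  "atts (rename_obj f x) = (\<lambda>a. map_option (map_aval f) (atts x a))"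
  "refs (rename_obj f x) = (\<lambda>R. map_option ((`) f) (refs x R))"
  by (cases x; simp)+

lemma set_rename_config [simp]: "set_mset (rename_config f G) = rename_obj f ` set_mset G"
  by (simp add: rename_config_def)

lemma idents_rename_config: "idents (rename_config f G) = f ` idents G"
  by (simp add: idents_def image_image)

lemma population_rename_config: "population (rename_config f G) K = population G K"
  by (simp add: population_def rename_config_def filter_mset_image_mset)

lemma rename_placeholders:
  "(\<lambda>a. map_option (map_aval f) (placeholders \<S> K i a)) = placeholders \<S> K (f i)"
proof -
  have "map_aval f (symbol s i a) = symbol s (f i) a" for s a by (cases s) simp_all
  then show ?thesis by (simp add: fun_eq_iff placeholders_def option.map_comp comp_def)
qed

lemma rename_respects_schema:
  assumes "renaming f" "respects_schema \<S> G"
  shows "respects_schema \<S> (rename_config f G)"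
  unfolding respects_schema_def
proof
  fix y assume "y \<in># rename_config f G"
  then obtain x where x: "x \<in># G" and y: "y = rename_obj f x" by auto
  have old: "class_of x \<in> set (class_list \<S>)" "oid_class (ident x) = class_of x"
    "atts x = placeholders \<S> (class_of x) (ident x)"
    "dom (refs x) = set (roles_of \<S> (class_of x))"
    using assms(2) x by (auto simp: respects_schema_def)
  have "X \<subseteq> {ident z |z. z \<in># rename_config f G \<and> subcls \<S> (class_of z) (tgt \<S> R)}"
    if "refs y R = Some X" for R X
  proof
    fix i assume "i \<in> X"
    with that obtain X' where "refs x R = Some X'" "i \<in> f ` X'" by (auto simp: y)
    moreover from this have "X' \<subseteq> {ident z |z. z \<in># G \<and> subcls \<S> (class_of z) (tgt \<S> R)}"
      using assms(2) x unfolding respects_schema_def by blast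
    ultimately obtain z where "z \<in># G" "subcls \<S> (class_of z) (tgt \<S> R)" "i = f (ident z)"
      by blast
    then have "rename_obj f z \<in># rename_config f G" "subcls \<S> (class_of (rename_obj f z)) (tgt \<S> R)"
      "i = ident (rename_obj f z)"
      by simp_all
    then show "i \<in> {ident z |z. z \<in># rename_config f G \<and> subcls \<S> (class_of z) (tgt \<S> R)}"
      by blast
  qed
  moreover have "dom (refs y) = dom (refs x)" by (auto simp: y dom_def)
  moreover have "oid_class (ident y) = oid_class (ident x)" "class_of y = class_of x"
    using assms(1) by (simp_all add: y renaming_def)
  moreover have "atts y = placeholders \<S> (class_of y) (ident y)"
    by (simp add: y old rename_placeholders)
  ultimately show "class_of y \<in> set (class_list \<S>) \<and> oid_class (ident y) = class_of y \<and>
      atts y = placeholders \<S> (class_of y) (ident y) \<and> dom (refs y) = set (roles_of \<S> (class_of y)) \<and>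
      (\<forall>R X. refs y R = Some X \<longrightarrow>
        X \<subseteq> {ident z |z. z \<in># rename_config f G \<and> subcls \<S> (class_of z) (tgt \<S> R)})"
    using old by simp
qed

text \<open>Bijectivity preserves cardinalities and uniqueness of identifiers, class preservation
  keeps the typing, and name independence handles the user-supplied parts.\<close>

lemma rename_instance:
  assumes f: "renaming f" and indep: "name_independent M" and inst: "(G, \<rho>) \<in> instances M"
  shows "(rename_config f G, rename_valuation f \<rho>) \<in> instances M"
proof -
  have inj: "inj f" using f by (simp add: renaming_def bij_is_inj)
  then have card: "card (f ` X) = card X" for X
    by (meson card_image inj_on_subset subset_UNIV)
  have indep': "extra_part M (rename_config f G) = extra_part M G"
    "inv_full M (rename_config f G) = inv_full M G"
    "sat (rename_valuation f \<rho>) (on_create M K (f i)) = sat \<rho> (on_create M K i)"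
    "sat (rename_valuation f \<rho>) (on_set_ref M K R (f i) (f ` X)) = sat \<rho> (on_set_ref M K R i X)"
    for K R i X
    using indep f unfolding name_independent_def by blast+
  have bounds: "respects_bounds M G" and part: "inv_part M G" and full: "inv_full M G"
    and attr: "sat_attr M \<rho> G"
    using inst by (auto simp: instances_def)
  have "respects_bounds M (rename_config f G)"
    using bounds rename_respects_schema[OF f, of "schema M" G]
    by (auto simp: respects_bounds_def population_rename_config card)
  moreover have "size (filter_mset (\<lambda>x. ident x = i) (rename_config f G)) \<le> 1" for i
  proof -
    have "filter_mset (\<lambda>x. f (ident x) = i) G = filter_mset (\<lambda>x. ident x = inv f i) G"
      using f by (intro filter_mset_cong) (auto simp: renaming_def bij_inv_eq_iff)
    then show ?thesis
      using part by (simp add: inv_part_def rename_config_def filter_mset_image_mset)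
  qed
  then have "inv_part M (rename_config f G)"
    using part by (auto simp: inv_part_def population_rename_config card indep'(1))
  moreover have "sat_attr M (rename_valuation f \<rho>) (rename_config f G)"
    using attr by (auto simp: sat_attr_def indep'(3,4))
  ultimately show ?thesis using full by (simp add: instances_def indep'(2))
qed

section \<open>Moving the indices of each class to an initial segment\<close>

text \<open>The class of an object can be read off its identifier and no identifier repeats, so
  counting objects amounts to counting indices.\<close>

lemma population_card:
  assumes "inv_part M G" "respects_schema \<S> G"
  shows "population G K = card {n. Oid K n \<in> idents G}"
proof -
  have "population G K = size (filter_mset (\<lambda>x. oid_class (ident x) = K) G)"
    unfolding population_def
    by (rule arg_cong[where f = size], rule filter_mset_cong)
       (use assms(2) in \<open>auto simp: respects_schema_def\<close>)
  also have "\<dots> = size (filter_mset (\<lambda>i. oid_class i = K) (image_mset ident G))"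
    by (simp add: filter_mset_image_mset)
  also have "\<dots> = card {i \<in> idents G. oid_class i = K}"
    by (simp add: image_ident[OF assms(1)] filter_mset_mset_set idents_def)
  also have "{i \<in> idents G. oid_class i = K} = Oid K ` {n. Oid K n \<in> idents G}"
    by (auto simp: image_iff) (metis oid.collapse)
  also have "card \<dots> = card {n. Oid K n \<in> idents G}"
    by (simp add: card_image inj_on_def)
  finally show ?thesis .
qed

text \<open>A bijection between the two finite sets of equal size is glued to one between their
  complements, giving a permutation of all naturals as \<open>renaming\<close> demands.\<close>

lemma finite_nat_set_to_initial_segment:
  assumes "finite (I :: nat set)"
  shows "\<exists>g. bij g \<and> g ` I = {..<card I}"
proof -
  let ?J = "{..<card I}"
  obtain h where h: "bij_betw h I ?J"
    using finite_same_card_bij[OF assms, of ?J] by auto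
  have "infinite (- I)" "infinite (- ?J)"
    using assms by (simp_all add: Compl_eq_Diff_UNIV)
  \<comment> \<open>Both complements are infinite sets of naturals; the element of a given rank in
    one goes to the element of that rank in the other.\<close>
  then have "bij_betw (enumerate (- ?J) \<circ> inv_into UNIV (enumerate (- I))) (- I) (- ?J)"
    by (meson bij_betw_inv_into bij_betw_trans bij_enumerate)
  then obtain h' where h': "bij_betw h' (- I) (- ?J)" by blast
  define g where "g n = (if n \<in> I then h n else h' n)" for n
  have g: "bij_betw g I ?J" "bij_betw g (- I) (- ?J)"
    using h h' bij_betw_cong[of I g h] bij_betw_cong[of "- I" g h'] by (simp_all add: g_def)
  from bij_betw_combine[OF this] have "bij g" by (simp only: Compl_disjoint Compl_partition simp_thms)
  with g(1) show ?thesis by (auto simp: bij_betw_def)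
qed

text \<open>Indices are permuted class by class onto initial segments. These contain the mandatory
  identifiers because \<open>bounds\<close> covers the lower class bound and \<open>demand\<close>
  the incoming need, capped at \<open>class_up\<close>.\<close>

lemma ex_canonical_renaming:
  assumes part: "inv_part M G" and bounds: "respects_bounds M G"
    and demand: "\<And>K. K \<in> classes M \<Longrightarrow> min (class_up M K) (in_need M K) \<le> population G K"
  shows "\<exists>f. renaming f \<and> canonically_named M (rename_config f G)"
proof -
  define I where "I K = {n. Oid K n \<in> idents G}" for K
  have "finite (I K)" for K
  proof -
    have "finite (Oid K -` idents G)"
      by (rule finite_vimageI) (auto simp: idents_def inj_def)
    then show ?thesis by (simp add: I_def vimage_def)
  qed
  then have "\<forall>K. \<exists>g. bij g \<and> g ` I K = {..<card (I K)}"
    by (blast intro: finite_nat_set_to_initial_segment)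
  from choice[OF this] obtain g
    where g: "\<And>K. bij (g K)" "\<And>K. g K ` I K = {..<card (I K)}" by blast
  define f where "f i = Oid (oid_class i) (g (oid_class i) (oid_index i))" for i
  have schema: "respects_schema (schema M) G" using bounds by (simp add: respects_bounds_def)
  have pop: "card (I K) = population G K" for K
    unfolding I_def using population_card[OF part schema] by simp
  have "inj f"
  proof (rule injI)
    fix i j assume "f i = f j"
    then have "oid_class i = oid_class j \<and>
        g (oid_class i) (oid_index i) = g (oid_class i) (oid_index j)"
      by (auto simp: f_def)
    then have "oid_class i = oid_class j" "oid_index i = oid_index j"
      using bij_is_inj[OF g(1)[of "oid_class i"]] by (blast dest: injD)+
    then show "i = j" by (simp add: oid.expand)
  qed
  moreover have "surj f"
  proof (rule surjI)
    fix i show "f (Oid (oid_class i) (inv (g (oid_class i)) (oid_index i))) = i"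
      using g(1) by (simp add: f_def bij_is_surj surj_f_inv_f)
  qed
  ultimately have "renaming f" by (simp add: renaming_def bij_def f_def)
  \<comment> \<open>After renaming, the identifiers of a class are exactly those with index below
    its population.\<close>
  moreover have img: "Oid K n \<in> f ` idents G \<longleftrightarrow> n < population G K" for K n
  proof -
    have "Oid K n \<in> f ` idents G \<longleftrightarrow> (\<exists>i \<in> idents G. oid_class i = K \<and> g K (oid_index i) = n)"
      by (auto simp: f_def image_iff)
    also have "\<dots> \<longleftrightarrow> (\<exists>m. Oid K m \<in> idents G \<and> g K m = n)"
      by (metis oid.collapse oid.sel)
    also have "\<dots> \<longleftrightarrow> n \<in> g K ` I K"
      by (auto simp: I_def)
    finally have "Oid K n \<in> f ` idents G \<longleftrightarrow> n \<in> g K ` I K" .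
    then show ?thesis by (simp add: g(2) pop)
  qed
  have "canonically_named M (rename_config f G)"
    unfolding canonically_named_def idents_rename_config
  proof (intro conjI ballI allI impI subsetI)
    fix i assume i: "i \<in> f ` idents G"
    obtain K n where Kn: "i = Oid K n" by (cases i)
    with i have "n < population G K" by (simp add: img)
    moreover have "K \<in> classes M"
      using i Kn schema by (auto simp: f_def idents_def respects_schema_def)
    ultimately show "i \<in> set (alloc_list M)"
      using bounds by (force simp: Kn set_alloc_list respects_bounds_def)
  next
    fix K n assume K: "K \<in> classes M" and n: "n < mandatory M K"
    have "class_lo M K \<le> population G K" using bounds K by (simp add: respects_bounds_def)
    with n demand[OF K] show "Oid K n \<in> f ` idents G" by (auto simp: img mandatory_def)
  qed
  with \<open>renaming f\<close> show ?thesis by blast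
qed

text \<open>Runs create only identifiers of the allocation list, so an instance with other names can
  be met only up to renaming; hence the two conclusions.\<close>

theorem theorem2:
  fixes M :: bounded_spec
    and simpB :: "oid bexp \<Rightarrow> oid bexp"
    and shape :: "state \<Rightarrow> 'k"
    and subsumes :: "state \<Rightarrow> state \<Rightarrow> bool"
    and A :: "state set"
    and G :: config
    and \<rho> :: "oid valuation"
  assumes spec: "wf_spec M"
    and simp_sound: "\<forall>\<rho>' \<phi>. sat \<rho>' (simpB \<phi>) = sat \<rho>' \<phi>"
    and test_sound: "\<forall>S1 S2. subsumes S1 S2 \<longrightarrow> subsumption_witness shape S1 S2"
    and complete: "search M simpB subsumes (accepted M simpB) A"
    and inst: "(G, \<rho>) \<in> instances M"
    and demand: "\<forall>K \<in> classes M. min (class_up M K) (in_need M K) \<le> population G K"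
  shows
    "(canonically_named M G \<longrightarrow>
        (\<exists>S \<in> A. reachable M simpB S \<and> accept_find M simpB S \<and> (G, \<rho>) \<in> denotation S)) \<and>
     (name_independent M \<longrightarrow>
        (\<exists>f. renaming f \<and>
          (\<exists>S \<in> A. reachable M simpB S \<and> accept_find M simpB S \<and>
             (rename_config f G, rename_valuation f \<rho>) \<in> denotation S)))"
proof -
  \<comment> \<open>The run yields an accepted state, and coverage replaces it by a member of
    \<open>A\<close> with at least the same denotation.\<close>
  have retained: "\<exists>S \<in> A. reachable M simpB S \<and> accept_find M simpB S \<and> (H, \<tau>) \<in> denotation S"
    if H: "(H, \<tau>) \<in> instances M" "canonically_named M H" for H \<tau>
  proof -
    obtain S where "S \<in> accepted M simpB" "(H, \<tau>) \<in> denotation S"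
      using reach_canonical[OF spec _ H, of simpB] simp_sound by blast
    moreover have "A \<subseteq> accepted M simpB"
      "\<forall>S \<in> accepted M simpB. \<exists>T \<in> A. denotation S \<subseteq> denotation T"
      using search_covers[OF complete, of shape] test_sound by blast+
    ultimately obtain T where "T \<in> A" "T \<in> accepted M simpB" "(H, \<tau>) \<in> denotation T" by blast
    then show ?thesis by (auto simp: accepted_def)
  qed
  have "inv_part M G" "respects_bounds M G" using inst by (auto simp: instances_def)
  then obtain f where "renaming f" "canonically_named M (rename_config f G)"
    using ex_canonical_renaming demand by blast
  with retained inst rename_instance show ?thesis by blast
qed

end
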